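(* Let $n\geq 1$. Suppose $\gamma\colon [0,1]\to \mathbb{R}^{2n+1}$ is an absolutely continuous horizontal curve in the Heisenberg group $\mathbb{H}^{n}$. Then, for any $\varepsilon>0$, there exists a $C^{1}$ horizontal curve $\Gamma\colon [0,1]\to \mathbb{R}^{2n+1}$ in $\mathbb{H}^{n}$ such that \[\mathcal{L}^{1} (\{t\in [0,1]:\Gamma(t)\neq \gamma(t)\text{ or }\Gamma'(t)\neq \gamma'(t)\})<\varepsilon.\]
   Context: $\mathcal{L}^1$ is Lebesgue measure on $\mathbb{R}$. A curve $\gamma\colon[a,b]\to\mathbb{R}^N$ is absolutely continuous if it is differentiable almost everywhere and $\gamma(t_2)=\gamma(t_1)+\int_{t_1}^{t_2}\gamma'(t)\,dt$ for all $t_1,t_2\in[a,b]$ (so $\gamma'$ exists almost everywhere; points where $\gamma'$ does not exist form a null set). The Heisenberg group $\mathbb{H}^n$ is $\mathbb{R}^{2n+1}$, with points written $(x,y,t)$, $x,y\in\mathbb{R}^n$, $t\in\mathbb{R}$, and group law \[(x,y,t)\cdot(x',y',t')=\Big(x+x',\,y+y',\,t+t'+2\sum_{i=1}^n(y_ix_i'-x_iy_i')\Big).\] Its horizontal vector fields are $X_i=\partial_{x_i}+2y_i\partial_t$ and $Y_i=\partial_{y_i}-2x_i\partial_t$, $1\leq i\leq n$. An absolutely continuous curve $\gamma$ in $\mathbb{R}^{2n+1}$ is horizontal if, for almost every $t$, $\gamma'(t)$ is a linear combination of $X_i(\gamma(t)),Y_i(\gamma(t))$, $1\leq i\leq n$.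 *)

theory Defs
  imports "HOL-Analysis.Analysis"
begin

type_synonym 'n heis = "(real ^ 'n) \<times> (real ^ 'n) \<times> real"

fun heis_mult :: "'n::finite heis \<Rightarrow> 'n heis \<Rightarrow> 'n heis" where
  "heis_mult (x, y, t) (x', y', t') =
     (x + x', y + y', t + t' + 2 * (\<Sum>i\<in>UNIV. y $ i * x' $ i - x $ i * y' $ i))"

fun heis_X :: "'n::finite \<Rightarrow> 'n heis \<Rightarrow> 'n heis" where
  "heis_X i (x, y, t) = (axis i 1, 0, 2 * y $ i)"

fun heis_Y :: "'n::finite \<Rightarrow> 'n heis \<Rightarrow> 'n heis" where
  "heis_Y i (x, y, t) = (0, axis i 1, - 2 * x $ i)"

text \<open>The fields are the left-invariant ones: they generate right translation along the
  coordinate axes.\<close>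

lemma heis_mult_axis_X: "heis_mult p (s *\<^sub>R axis i 1, 0, 0) = p + s *\<^sub>R heis_X i p"
  by (cases p) (simp add: axis_def if_distrib if_distribR cong: if_cong)

lemma heis_mult_axis_Y: "heis_mult p (0, s *\<^sub>R axis i 1, 0) = p + s *\<^sub>R heis_Y i p"
  by (cases p) (simp add: axis_def if_distrib if_distribR cong: if_cong)

text \<open>Curves on \<open>[a, b]\<close> are total functions of which only the values on \<open>{a..b}\<close> matter, so
  derivatives are taken within \<open>{a..b}\<close> (one-sided at the endpoints). The interval integral is
  oriented, so \<open>t\<^sub>1 > t\<^sub>2\<close> is allowed. Integrability of the derivative is stated explicitly
  because the library's integral of a non-integrable function is 0.\<close>

definition absolutely_continuous_curve ::
    "real \<Rightarrow> real \<Rightarrow> (real \<Rightarrow> 'a::euclidean_space) \<Rightarrow> bool" where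
  "absolutely_continuous_curve a b \<gamma> \<longleftrightarrow>
     (AE t in lebesgue. t \<in> {a..b} \<longrightarrow> \<gamma> differentiable (at t within {a..b})) \<and>
     set_integrable lebesgue {a..b} (\<lambda>t. vector_derivative \<gamma> (at t within {a..b})) \<and>
     (\<forall>t\<^sub>1\<in>{a..b}. \<forall>t\<^sub>2\<in>{a..b}.
        \<gamma> t\<^sub>2 = \<gamma> t\<^sub>1 + (LINT t=t\<^sub>1..t\<^sub>2|lebesgue. vector_derivative \<gamma> (at t within {a..b})))"

definition horizontal_curve ::
    "real \<Rightarrow> real \<Rightarrow> (real \<Rightarrow> 'n::finite heis) \<Rightarrow> bool" where
  "horizontal_curve a b \<gamma> \<longleftrightarrow>
     absolutely_continuous_curve a b \<gamma> \<and>
     (AE t in lebesgue. t \<in> {a..b} \<longrightarrow>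
        (\<exists>v \<in> span (range (\<lambda>i. heis_X i (\<gamma> t)) \<union> range (\<lambda>i. heis_Y i (\<gamma> t))).
           (\<gamma> has_vector_derivative v) (at t within {a..b})))"

text \<open>Unlike the library's \<^const>\<open>C1_differentiable_on\<close>, which uses two-sided derivatives, this does
  not depend on values outside \<open>{a..b}\<close>.\<close>

definition C1_curve :: "real \<Rightarrow> real \<Rightarrow> (real \<Rightarrow> 'a::real_normed_vector) \<Rightarrow> bool" where
  "C1_curve a b \<gamma> \<longleftrightarrow>
     (\<exists>D. (\<forall>t\<in>{a..b}. (\<gamma> has_vector_derivative D t) (at t within {a..b})) \<and>
          continuous_on {a..b} D)"

end

theory Submission
  imports Defs
begin

text \<open>
  A curve in the Heisenberg group is horizontal if its height \<open>\<theta>\<close> is determined, up to a constant, by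
  its projection \<open>z\<close> to the horizontal layer through \<open>\<theta>' = 2 * \<omega>(z, z')\<close>, where \<open>\<omega>\<close> is the standard
  symplectic form. So a change of \<open>z\<close> on an interval also changes the height gained over that interval, by
  a symplectic area. This is why a plain \<open>C\<^sup>1\<close> Lusin approximation of the coordinates does not suffice.

  The velocity of \<open>\<gamma>\<close> is integrable. Hence, off a set of small measure, it is continuous and all points
  are Lebesgue points of it, with a uniform rate (\<open>uniform_lebesgue_points\<close>). Let \<open>K\<close> be a closed
  set of such points. For \<open>a\<close> in \<open>K\<close> and \<open>b\<close> near \<open>a\<close>, the horizontal part of \<open>\<gamma>\<close> is
  differentiable with a uniform error, and the height of \<open>\<gamma>(b)\<close> relative to \<open>\<gamma>(a)\<close> is
  \<open>o((b - a)\<^sup>2)\<close> (\<open>horizontal_curve_taylor\<close>). The second estimate is the decisive one. It holds because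
  the main term of the area integrand is \<open>\<omega>\<close> of a vector with itself, and the error is controlled in mean
  at a Lebesgue point.

  The curve \<open>\<gamma>\<close> is kept on \<open>K\<close> and replaced in each complementary interval \<open>(a, b)\<close> by a \<open>C\<^sup>1\<close>
  horizontal curve with the same end points and with the velocities of \<open>\<gamma>\<close> at its ends
  (\<open>horizontal_whitney_extension\<close>). Rescaled to unit length, this curve has to enclose the area \<open>o(1)\<close>, which
  is corrected by a loop of amplitude \<open>o(1)\<close> added to a quadratic interpolation of the velocity
  (\<open>horizontal_unit_interpolant\<close>). So the velocity in a short gap is close to that at the end of the gap,
  and the resulting curve is \<open>C\<^sup>1\<close> (\<open>continuous_on_glue\<close>, \<open>has_vector_derivative_glue\<close>).
\<close>

section \<open>Uniform Lebesgue points\<close>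

text \<open>
  Select the intervals on which the average of \<open>f\<close> exceeds \<open>l\<close>. By Vitali's covering lemma countably
  many disjoint ones among them suffice to cover all of them after enlargement by the factor 5.
  The total length of the disjoint ones is at most \<open>1 / l\<close> times the integral of \<open>f\<close>. The set
  \<open>T\<close> is the enlarged cover itself, so measurability of the set where the maximal function is
  large never has to be discussed.
\<close>

lemma weak_type_maximal_inequality:
  fixes f :: "real \<Rightarrow> ennreal"
  assumes f [measurable]: "f \<in> borel_measurable lebesgue"
    and fin: "(\<integral>\<^sup>+x. f x \<partial>lebesgue) < \<infinity>" and l: "l > 0"
  obtains T where "T \<in> sets lebesgue"
    "emeasure lebesgue T \<le> ennreal (5 / l) * (\<integral>\<^sup>+x. f x \<partial>lebesgue)"
    "\<And>x a b. a < b \<Longrightarrow> x \<in> {a..b} \<Longrightarrow> x \<notin> T \<Longrightarrow>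
       (\<integral>\<^sup>+s\<in>{a..b}. f s \<partial>lebesgue) \<le> ennreal (l * (b - a))"
proof -
  define K where "K = {(a, b). a < b \<and> ennreal (l * (b - a)) < (\<integral>\<^sup>+s\<in>{a..b}. f s \<partial>lebesgue)}"
  define c where "c i = (fst i + snd i) / 2" for i :: "real \<times> real"
  define r where "r i = (snd i - fst i) / 2" for i :: "real \<times> real"
  define N where "N = density lebesgue f"
  have N: "emeasure N A = (\<integral>\<^sup>+s\<in>A. f s \<partial>lebesgue)" if "A \<in> sets lebesgue" for A
    unfolding N_def using that by (simp add: emeasure_density)
  have setsN: "sets N = sets lebesgue" by (simp add: N_def)
  have cb: "cball (c i) (r i) = {fst i..snd i}" for i
    unfolding c_def r_def cball_eq_atLeastAtMost by (simp add: field_simps)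
  define J where "J = (\<integral>\<^sup>+x. f x \<partial>lebesgue)"
  have le_J: "(\<integral>\<^sup>+s\<in>A. f s \<partial>lebesgue) \<le> J" for A
    unfolding J_def by (intro nn_integral_mono) (auto simp: indicator_def)
  have J: "J < \<infinity>" using fin by (simp add: J_def)
  \<comment> \<open>Selected intervals have bounded length because \<open>f\<close> is integrable; the covering lemma needs this.\<close>
  have bd: "0 < r i \<and> r i \<le> enn2real J / l" if "i \<in> K" for i
  proof -
    have i: "fst i < snd i" "ennreal (l * (snd i - fst i)) < J"
      using that le_J[of "{fst i..snd i}"] by (auto simp: K_def)
    then have "l * (snd i - fst i) < enn2real J"
      using J l by (cases J) (auto simp: ennreal_less_iff)
    moreover have "l * r i \<le> l * (snd i - fst i)" using l i by (simp add: r_def)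
    ultimately have "l * r i \<le> enn2real J" by linarith
    then show ?thesis using l i by (auto simp: r_def field_simps)
  qed
  obtain C where C: "countable C" "C \<subseteq> K"
     "pairwise (\<lambda>i j. disjnt (cball (c i) (r i)) (cball (c j) (r j))) C"
     "(\<Union>i\<in>K. cball (c i) (r i)) \<subseteq> (\<Union>i\<in>C. cball (c i) (5 * r i))"
    by (rule Vitali_covering_lemma_cballs[OF order_refl, of K r "enn2real J / l" c]) (use bd in auto)
  \<comment> \<open>Reindex the countable family by the naturals, padded with empty sets.\<close>
  define B where "B n = (if n \<in> to_nat_on C ` C then cball (c (from_nat_into C n)) (r (from_nat_into C n)) else {})" for n
  define B5 where "B5 n = (if n \<in> to_nat_on C ` C then cball (c (from_nat_into C n)) (5 * r (from_nat_into C n)) else {})" for n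
  have inC: "n \<in> to_nat_on C ` C \<Longrightarrow> from_nat_into C n \<in> C" for n
    using C(1) by auto
  have UB5: "(\<Union>n. B5 n) = (\<Union>i\<in>C. cball (c i) (5 * r i))"
    using C(1) by (auto simp: B5_def split: if_splits)
  have mB: "B n \<in> sets lebesgue" "B5 n \<in> sets lebesgue" for n
    by (auto simp: B_def B5_def)
  have disj: "disjoint_family B"
    unfolding disjoint_family_on_def
  proof (intro ballI impI)
    fix m n :: nat assume "m \<noteq> n"
    show "B m \<inter> B n = {}"
    proof (cases "m \<in> to_nat_on C ` C \<and> n \<in> to_nat_on C ` C")
      case True
      then have "from_nat_into C m \<noteq> from_nat_into C n"
        using \<open>m \<noteq> n\<close> C(1) by auto
      then show ?thesis
        using C(3) True inC unfolding pairwise_def disjnt_def B_def by auto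
    qed (auto simp: B_def)
  qed
  have key: "emeasure lebesgue (B5 n) \<le> ennreal (5 / l) * emeasure N (B n)" for n
  proof (cases "n \<in> to_nat_on C ` C")
    case True
    define i where "i = from_nat_into C n"
    have iK: "i \<in> K" using True inC C(2) by (auto simp: i_def)
    have ri: "r i > 0" using bd iK by auto
    have "emeasure lebesgue (B5 n) = ennreal (10 * r i)"
      using ri True by (simp add: B5_def i_def[symmetric] cball_eq_atLeastAtMost)
    also have "\<dots> = ennreal (5 / l) * ennreal (l * (snd i - fst i))"
      using l ri by (subst ennreal_mult[symmetric]) (auto simp: r_def)
    also have "\<dots> \<le> ennreal (5 / l) * (\<integral>\<^sup>+s\<in>{fst i..snd i}. f s \<partial>lebesgue)"
      using iK by (intro mult_left_mono) (auto simp: K_def)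
    also have "\<dots> = ennreal (5 / l) * emeasure N (B n)"
      using True by (simp add: N B_def i_def[symmetric] cb)
    finally show ?thesis .
  qed (auto simp: B5_def)
  let ?T = "\<Union>n. B5 n"
  show ?thesis
  proof
    show "?T \<in> sets lebesgue" using mB by auto
    have "emeasure lebesgue ?T \<le> (\<Sum>n. emeasure lebesgue (B5 n))"
      using mB by (intro emeasure_subadditive_countably) auto
    also have "\<dots> \<le> (\<Sum>n. ennreal (5 / l) * emeasure N (B n))"
      by (intro suminf_le key) auto
    also have "\<dots> = ennreal (5 / l) * (\<Sum>n. emeasure N (B n))"
      by simp
    also have "(\<Sum>n. emeasure N (B n)) = emeasure N (\<Union>n. B n)"
      using mB disj setsN by (intro suminf_emeasure) auto
    also have "\<dots> = (\<integral>\<^sup>+s\<in>(\<Union>n. B n). f s \<partial>lebesgue)"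
      using mB by (intro N) auto
    also have "\<dots> \<le> J" by (rule le_J)
    finally show "emeasure lebesgue ?T \<le> ennreal (5 / l) * (\<integral>\<^sup>+x. f x \<partial>lebesgue)"
      by (simp add: mult_left_mono J_def)
    fix x a b :: real assume ab: "a < b" "x \<in> {a..b}" "x \<notin> ?T"
    show "(\<integral>\<^sup>+s\<in>{a..b}. f s \<partial>lebesgue) \<le> ennreal (l * (b - a))"
    proof (rule ccontr)
      assume "\<not> ?thesis"
      then have "(a, b) \<in> K" using ab by (auto simp: K_def)
      moreover have "x \<in> cball (c (a, b)) (r (a, b))" using ab by (simp add: cb)
      ultimately show False using C(4) ab(3) UB5 by blast
    qed
  qed
qed

lemma continuous_imp_lebesgue_measurable:
  fixes g :: "'a::euclidean_space \<Rightarrow> 'b::euclidean_space"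
  assumes "continuous_on UNIV g"
  shows "g \<in> borel_measurable lebesgue"
  using borel_measurable_continuous_onI[OF assms] by (intro measurable_completion) simp

text \<open>
  Density of continuous functions in \<open>L\<^sup>1\<close>: for an indicator function this is Urysohn's lemma between a
  closed set inside and an open set outside, and both sums and dominated limits inherit it.
\<close>

lemma integrable_approx_continuous:
  fixes f :: "'a::euclidean_space \<Rightarrow> 'b::euclidean_space"
  assumes "integrable lebesgue f" and "e > 0"
  shows "\<exists>g. continuous_on UNIV g \<and> (\<integral>\<^sup>+x. ennreal (norm (f x - g x)) \<partial>lebesgue) < ennreal e"
  using assms
proof (induction f arbitrary: e rule: integrable_induct)
  case (base A c)
  define d where "d = e / (3 * (norm c + 1))"
  have d: "d > 0" using base by (auto simp: d_def intro!: divide_pos_pos add_nonneg_pos)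
  obtain U where U: "open U" "A \<subseteq> U" "emeasure lebesgue (U - A) < ennreal d" "U - A \<in> lmeasurable"
    using sets_lebesgue_outer_open[OF base(1) d] by metis
  obtain T where T: "closed T" "T \<subseteq> A" "emeasure lebesgue (A - T) < ennreal d" "A - T \<in> lmeasurable"
    using sets_lebesgue_inner_closed[OF base(1) d] by metis
  have TU: "closed (- U)" "(- U) \<inter> T = {}" using U T by auto
  obtain g :: "'a \<Rightarrow> 'b" where g: "continuous_on UNIV g"
      "\<And>x. g x \<in> closed_segment 0 c" "\<And>x. x \<in> - U \<Longrightarrow> g x = 0" "\<And>x. x \<in> T \<Longrightarrow> g x = c"
    by (rule Urysohn[OF TU(1) T(1) TU(2), of 0 c]) auto
  have seg: "norm (g x) \<le> norm c \<and> norm (c - g x) \<le> norm c" for x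
  proof -
    obtain u where u: "0 \<le> u" "u \<le> 1" "g x = u *\<^sub>R c"
      using g(2)[of x] by (auto simp: in_segment)
    have "c - g x = (1 - u) *\<^sub>R c" using u by (simp add: algebra_simps)
    then show ?thesis using u by (simp add: mult_left_le_one_le)
  qed
  have pt: "ennreal (norm (indicator A x *\<^sub>R c - g x)) \<le> ennreal (norm c) * indicator ((U - A) \<union> (A - T)) x" for x
    using seg[of x] g(3)[of x] g(4)[of x] U(2) T(2) by (auto simp: indicator_def)
  have "(\<integral>\<^sup>+x. ennreal (norm (indicator A x *\<^sub>R c - g x)) \<partial>lebesgue)
      \<le> (\<integral>\<^sup>+x. ennreal (norm c) * indicator ((U - A) \<union> (A - T)) x \<partial>lebesgue)"
    by (intro nn_integral_mono pt)
  also have "\<dots> = ennreal (norm c) * emeasure lebesgue ((U - A) \<union> (A - T))"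
    using U(4) T(4) by (intro nn_integral_cmult_indicator) (auto dest: fmeasurableD)
  also have "\<dots> \<le> ennreal (norm c) * (ennreal d + ennreal d)"
    using U(3,4) T(3,4)
    by (intro mult_left_mono order_trans[OF emeasure_subadditive] add_mono) (auto dest: fmeasurableD)
  also have "\<dots> = ennreal (norm c * (d + d))"
    using d by (simp add: ennreal_mult flip: ennreal_plus)
  also have "\<dots> < ennreal e"
  proof -
    have nz: "norm c + 1 \<noteq> 0" using norm_ge_zero[of c] by linarith
    have "norm c * (d + d) \<le> (norm c + 1) * (2 * d)" using d by (simp add: algebra_simps)
    also have "\<dots> = 2 / 3 * e" using nz by (simp add: d_def field_simps)
    also have "\<dots> < e" using base by simp
    finally show ?thesis using base by (intro ennreal_lessI)
  qed
  finally show ?case using g(1) by blast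
next
  case (add f1 f2)
  obtain g1 where g1: "continuous_on UNIV g1" "(\<integral>\<^sup>+x. ennreal (norm (f1 x - g1 x)) \<partial>lebesgue) < ennreal (e / 2)"
    using add(3)[of "e/2"] add.prems by auto
  obtain g2 where g2: "continuous_on UNIV g2" "(\<integral>\<^sup>+x. ennreal (norm (f2 x - g2 x)) \<partial>lebesgue) < ennreal (e / 2)"
    using add(4)[of "e/2"] add.prems by auto
  have [measurable]: "f1 \<in> borel_measurable lebesgue" "f2 \<in> borel_measurable lebesgue"
      "g1 \<in> borel_measurable lebesgue" "g2 \<in> borel_measurable lebesgue"
    using add(1,2) g1(1) g2(1) by (auto intro: continuous_imp_lebesgue_measurable)
  have "(\<integral>\<^sup>+x. ennreal (norm (f1 x + f2 x - (g1 x + g2 x))) \<partial>lebesgue)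
     \<le> (\<integral>\<^sup>+x. ennreal (norm (f1 x - g1 x)) + ennreal (norm (f2 x - g2 x)) \<partial>lebesgue)"
    by (intro nn_integral_mono) (simp add: norm_diff_triangle_ineq flip: ennreal_plus)
  also have "\<dots> = (\<integral>\<^sup>+x. ennreal (norm (f1 x - g1 x)) \<partial>lebesgue) + (\<integral>\<^sup>+x. ennreal (norm (f2 x - g2 x)) \<partial>lebesgue)"
    by (intro nn_integral_add) measurable
  also have "\<dots> < ennreal (e / 2) + ennreal (e / 2)"
    using g1(2) g2(2) by (intro add_strict_mono)
  also have "\<dots> = ennreal e" using add.prems by (simp flip: ennreal_plus)
  finally show ?case using g1(1) g2(1)
    by (intro exI[of _ "\<lambda>x. g1 x + g2 x"]) (auto intro: continuous_on_add)
next
  case (lim f s)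
  have [measurable]: "f \<in> borel_measurable lebesgue" "\<And>i. s i \<in> borel_measurable lebesgue"
    using lim by auto
  have "(\<lambda>i. (\<integral>\<^sup>+x. norm (f x - s i x) \<partial>lebesgue)) \<longlonglongrightarrow> 0"
  proof (rule nn_integral_dominated_convergence_norm[where w="\<lambda>x. 2 * norm (f x)"])
    show "(\<integral>\<^sup>+x. ennreal (2 * norm (f x)) \<partial>lebesgue) < \<infinity>"
      using \<open>integrable lebesgue f\<close> by (auto simp: integrable_iff_bounded nn_integral_cmult ennreal_mult ennreal_mult_less_top)
  qed (use lim in auto)
  then have "\<forall>\<^sub>F i in sequentially. (\<integral>\<^sup>+x. norm (f x - s i x) \<partial>lebesgue) < ennreal (e / 2)"
    using lim.prems by (intro order_tendstoD(2)) auto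
  then obtain i where i: "(\<integral>\<^sup>+x. norm (f x - s i x) \<partial>lebesgue) < ennreal (e / 2)"
    by (auto simp: eventually_sequentially)
  obtain g where g: "continuous_on UNIV g" "(\<integral>\<^sup>+x. ennreal (norm (s i x - g x)) \<partial>lebesgue) < ennreal (e / 2)"
    using lim.IH[of "e/2" i] lim.prems by auto
  have [measurable]: "g \<in> borel_measurable lebesgue"
    using g(1) by (auto intro: continuous_imp_lebesgue_measurable)
  have "(\<integral>\<^sup>+x. ennreal (norm (f x - g x)) \<partial>lebesgue)
     \<le> (\<integral>\<^sup>+x. ennreal (norm (f x - s i x)) + ennreal (norm (s i x - g x)) \<partial>lebesgue)"
    by (intro nn_integral_mono) (use norm_triangle_ineq[of "f x - s i x" "s i x - g x" for x] in \<open>simp flip: ennreal_plus\<close>)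
  also have "\<dots> = (\<integral>\<^sup>+x. ennreal (norm (f x - s i x)) \<partial>lebesgue) + (\<integral>\<^sup>+x. ennreal (norm (s i x - g x)) \<partial>lebesgue)"
    by (intro nn_integral_add) measurable
  also have "\<dots> < ennreal (e / 2) + ennreal (e / 2)"
    using g(2) i by (intro add_strict_mono) auto
  also have "\<dots> = ennreal e" using lim.prems by (simp flip: ennreal_plus)
  finally show ?case using g(1) by blast
qed

text \<open>
  Lusin's theorem, Lebesgue's differentiation theorem and Egorov's theorem in one, with a common
  direct proof. Choose continuous functions \<open>g k\<close> that converge to \<open>f\<close> in
  \<open>L\<^sup>1\<close> very fast. Markov's inequality and the maximal inequality, both applied to
  \<open>norm (f - g k)\<close>, show that off a small set both \<open>norm (f - g k)\<close> and all its averages are at most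
  \<open>(1/2)^k\<close>. So \<open>f\<close> is there a uniform limit of continuous functions, and its oscillation in mean is
  controlled by the modulus of continuity of \<open>g k\<close>.
\<close>

lemma uniform_lebesgue_points:
  fixes f :: "real \<Rightarrow> 'b::euclidean_space"
  assumes f: "integrable lebesgue f" and e: "e > 0"
  obtains T where "T \<in> sets lebesgue" "emeasure lebesgue T < ennreal e"
    "continuous_on ({u..v} - T) f"
    "\<And>\<eta>. \<eta> > 0 \<Longrightarrow> \<exists>r>0. \<forall>x a b. x \<notin> T \<longrightarrow> u \<le> a \<longrightarrow> a < b \<longrightarrow> b \<le> v \<longrightarrow> x \<in> {a..b} \<longrightarrow> b - a < r \<longrightarrow>
       (\<integral>\<^sup>+s\<in>{a..b}. ennreal (norm (f s - f x)) \<partial>lebesgue) \<le> ennreal (\<eta> * (b - a))"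
proof -
  \<comment> \<open>\<open>q k\<close> is the accuracy at stage \<open>k\<close>. The bad set of stage \<open>k\<close> has measure at most \<open>6 * c k / q k\<close>:\<close>
  \<comment> \<open>5 from the maximal inequality and 1 from Markov. The choice of \<open>c\<close> makes these bounds sum to \<open>e / 2\<close>.\<close>
  define q :: "nat \<Rightarrow> real" where "q k = (1/2)^k" for k
  define c where "c k = e / 12 * (1/2)^Suc k * q k" for k
  have q: "q k > 0" for k by (simp add: q_def)
  have c: "c k > 0" for k using e q by (simp add: c_def)
  have "\<exists>g. \<forall>k. continuous_on UNIV (g k) \<and>
      (\<integral>\<^sup>+x. ennreal (norm (f x - g k x)) \<partial>lebesgue) < ennreal (c k)"
    using integrable_approx_continuous[OF f c] by metis
  then obtain g where gc: "\<And>k. continuous_on UNIV (g k)"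
    and gi: "\<And>k. (\<integral>\<^sup>+x. ennreal (norm (f x - g k x)) \<partial>lebesgue) < ennreal (c k)"
    by blast
  have [measurable]: "f \<in> borel_measurable lebesgue" using f by auto
  have [measurable]: "g k \<in> borel_measurable lebesgue" for k
    using gc by (auto intro: continuous_imp_lebesgue_measurable)
  have "\<forall>k. \<exists>T. T \<in> sets lebesgue \<and> emeasure lebesgue T \<le> ennreal (e / 2 * (1/2)^Suc k) \<and>
     (\<forall>x. x \<notin> T \<longrightarrow> norm (f x - g k x) < q k \<and>
       (\<forall>a b. a < b \<longrightarrow> x \<in> {a..b} \<longrightarrow>
       (\<integral>\<^sup>+s\<in>{a..b}. ennreal (norm (f s - g k s)) \<partial>lebesgue) \<le> ennreal (q k * (b - a))))"
  proof
    fix k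
    let ?I = "\<integral>\<^sup>+x. ennreal (norm (f x - g k x)) \<partial>lebesgue"
    have fin: "?I < \<infinity>" using gi[of k] by (simp add: less_top order_less_trans)
    obtain T1 where T1: "T1 \<in> sets lebesgue" "emeasure lebesgue T1 \<le> ennreal (5 / q k) * ?I"
      "\<And>x a b. a < b \<Longrightarrow> x \<in> {a..b} \<Longrightarrow> x \<notin> T1 \<Longrightarrow>
       (\<integral>\<^sup>+s\<in>{a..b}. ennreal (norm (f s - g k s)) \<partial>lebesgue) \<le> ennreal (q k * (b - a))"
      by (rule weak_type_maximal_inequality[of "\<lambda>x. ennreal (norm (f x - g k x))" "q k"]) (use q fin in auto)
    define T2 where "T2 = {x \<in> UNIV. 1 \<le> ennreal (1 / q k) * ennreal (norm (f x - g k x))}"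
    have T2m: "T2 \<in> sets lebesgue"
    proof -
      have "T2 = {x \<in> space lebesgue. 1 \<le> ennreal (1 / q k) * ennreal (norm (f x - g k x))}" by (simp add: T2_def)
      also have "\<dots> \<in> sets lebesgue" by measurable
      finally show ?thesis .
    qed
    have T2e: "emeasure lebesgue T2 \<le> ennreal (1 / q k) * ?I"
      using nn_integral_Markov_inequality[of "\<lambda>x. ennreal (norm (f x - g k x))" UNIV lebesgue "ennreal (1 / q k)"]
      by (simp add: T2_def)
    have "emeasure lebesgue (T1 \<union> T2) \<le> emeasure lebesgue T1 + emeasure lebesgue T2"
      using T1 T2m by (intro emeasure_subadditive)
    also have "\<dots> \<le> ennreal (5 / q k) * ?I + ennreal (1 / q k) * ?I"
      by (intro add_mono T1 T2e)
    also have "\<dots> = ennreal (6 / q k) * ?I"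
      using q[of k] by (simp flip: distrib_right ennreal_plus add: field_simps)
    also have "\<dots> \<le> ennreal (6 / q k) * ennreal (c k)"
      using gi[of k] by (intro mult_left_mono) auto
    also have "\<dots> = ennreal (e / 2 * (1/2)^Suc k)"
      using q[of k] c[of k] by (subst ennreal_mult[symmetric]) (auto simp: c_def)
    finally have "emeasure lebesgue (T1 \<union> T2) \<le> ennreal (e / 2 * (1/2)^Suc k)" .
    moreover have "norm (f x - g k x) < q k" if "x \<notin> T2" for x
    proof -
      have "\<not> 1 \<le> ennreal (norm (f x - g k x) / q k)"
        using that q[of k] by (simp add: T2_def flip: ennreal_mult)
      then have "norm (f x - g k x) / q k < 1"
        by (metis ennreal_1 ennreal_leI not_le)
      then show ?thesis using q[of k] by (simp add: field_simps)
    qed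
    ultimately show "\<exists>T. T \<in> sets lebesgue \<and> emeasure lebesgue T \<le> ennreal (e / 2 * (1/2)^Suc k) \<and>
     (\<forall>x. x \<notin> T \<longrightarrow> norm (f x - g k x) < q k \<and>
       (\<forall>a b. a < b \<longrightarrow> x \<in> {a..b} \<longrightarrow>
       (\<integral>\<^sup>+s\<in>{a..b}. ennreal (norm (f s - g k s)) \<partial>lebesgue) \<le> ennreal (q k * (b - a))))"
      using T1 T2m by (intro exI[of _ "T1 \<union> T2"]) auto
  qed
  from choice[OF this] obtain T where T: "\<And>k. T k \<in> sets lebesgue" "\<And>k. emeasure lebesgue (T k) \<le> ennreal (e / 2 * (1/2)^Suc k)"
     "\<And>k x. x \<notin> T k \<Longrightarrow> norm (f x - g k x) < q k"
     "\<And>k x a b. x \<notin> T k \<Longrightarrow> a < b \<Longrightarrow> x \<in> {a..b} \<Longrightarrow>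
       (\<integral>\<^sup>+s\<in>{a..b}. ennreal (norm (f s - g k s)) \<partial>lebesgue) \<le> ennreal (q k * (b - a))"
    by blast
  have q0: "\<exists>N. \<forall>n\<ge>N. q n < d" if d: "d > 0" for d
  proof -
    obtain N where N: "(1/2::real)^N < d" using real_arch_pow_inv[OF d, of "1/2"] by auto
    have "q n < d" if nN: "n \<ge> N" for n
    proof -
      have "(1/2::real)^n \<le> (1/2)^N" using nN by (intro power_decreasing) auto
      then show ?thesis using N by (simp only: q_def)
    qed
    then show ?thesis by blast
  qed
  show ?thesis
  proof (rule that[of "\<Union>k. T k"])
    show "(\<Union>k. T k) \<in> sets lebesgue" using T(1) by blast
    have "emeasure lebesgue (\<Union>k. T k) \<le> (\<Sum>k. emeasure lebesgue (T k))"
      using T(1) by (intro emeasure_subadditive_countably) auto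
    also have "\<dots> \<le> (\<Sum>k. ennreal (e / 2 * (1/2)^Suc k))"
      by (intro suminf_le T) auto
    also have "\<dots> = ennreal (e / 2 * 1)"
      using e by (intro suminf_ennreal_eq sums_mult power_half_series) auto
    also have "\<dots> < ennreal e" using e by (intro ennreal_lessI) auto
    finally show "emeasure lebesgue (\<Union>k. T k) < ennreal e" .
    have "uniform_limit ({u..v} - (\<Union>k. T k)) g f sequentially"
    proof (rule uniform_limitI)
      fix d :: real assume "d > 0"
      then obtain N where N: "\<forall>n\<ge>N. q n < d" using q0 by blast
      have "dist (g n x) (f x) < d" if "n \<ge> N" "x \<notin> (\<Union>k. T k)" for n x
      proof -
        have "norm (f x - g n x) < q n" "q n < d" using T(3)[of x n] that N by auto
        then show ?thesis by (simp add: dist_norm norm_minus_commute)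
      qed
      then show "\<forall>\<^sub>F n in sequentially. \<forall>x\<in>{u..v} - (\<Union>k. T k). dist (g n x) (f x) < d"
        unfolding eventually_sequentially by (intro exI[of _ N]) blast
    qed
    then show "continuous_on ({u..v} - (\<Union>k. T k)) f"
      by (rule uniform_limit_theorem[rotated])
         (simp_all add: continuous_on_subset[OF gc])
    fix \<eta> :: real assume \<eta>: "\<eta> > 0"
    then obtain k where k: "q k < \<eta> / 3" using q0[of "\<eta> / 3"] by auto
    have "uniformly_continuous_on {u..v} (g k)"
      using gc by (intro compact_uniformly_continuous) (auto intro: continuous_on_subset)
    then obtain r where r: "r > 0"
        "\<And>x x'. x \<in> {u..v} \<Longrightarrow> x' \<in> {u..v} \<Longrightarrow> dist x' x < r \<Longrightarrow> dist (g k x') (g k x) < \<eta> / 3"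
      using \<eta> unfolding uniformly_continuous_on_def by (metis divide_pos_pos zero_less_numeral)
    have "(\<integral>\<^sup>+s\<in>{a..b}. ennreal (norm (f s - f x)) \<partial>lebesgue) \<le> ennreal (\<eta> * (b - a))"
      if x: "x \<notin> (\<Union>k. T k)" "x \<in> {a..b}" and ab: "u \<le> a" "a < b" "b \<le> v" "b - a < r" for x a b
    proof -
      have pt: "norm (f s - f x) \<le> norm (f s - g k s) + 2 / 3 * \<eta>" if "s \<in> {a..b}" for s
      proof -
        have "norm (f s - f x) \<le> norm (f s - g k s) + norm (g k s - g k x) + norm (f x - g k x)"
          by norm
        moreover have "norm (g k s - g k x) < \<eta> / 3"
          using r(2)[of x s] ab x that by (auto simp: dist_norm)
        moreover have "norm (f x - g k x) < \<eta> / 3" using T(3)[of x k] x k by fastforce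
        ultimately show ?thesis by linarith
      qed
      have "(\<integral>\<^sup>+s\<in>{a..b}. ennreal (norm (f s - f x)) \<partial>lebesgue)
         \<le> (\<integral>\<^sup>+s. ennreal (norm (f s - g k s)) * indicator {a..b} s + ennreal (2 / 3 * \<eta>) * indicator {a..b} s \<partial>lebesgue)"
        using pt \<eta> by (intro nn_integral_mono) (auto simp: indicator_def simp flip: ennreal_plus)
      also have "\<dots> = (\<integral>\<^sup>+s\<in>{a..b}. ennreal (norm (f s - g k s)) \<partial>lebesgue) + ennreal (2 / 3 * \<eta>) * emeasure lebesgue {a..b}"
      proof -
        have "(\<lambda>s. ennreal (norm (f s - g k s)) * indicator {a..b} s) \<in> borel_measurable lebesgue"
          by (intro borel_measurable_times_ennreal borel_measurable_indicator) auto
        moreover have "(\<lambda>s. ennreal (2 / 3 * \<eta>) * indicator {a..b} s) \<in> borel_measurable lebesgue"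
          by (intro borel_measurable_times_ennreal borel_measurable_indicator) auto
        moreover have "(\<integral>\<^sup>+s\<in>{a..b}. ennreal (2 / 3 * \<eta>) \<partial>lebesgue) = ennreal (2 / 3 * \<eta>) * emeasure lebesgue {a..b}"
          by (rule nn_integral_cmult_indicator) simp
        ultimately show ?thesis
          by (subst nn_integral_add) simp_all
      qed
      also have "\<dots> \<le> ennreal (q k * (b - a)) + ennreal (2 / 3 * \<eta>) * ennreal (b - a)"
        using x ab T(4)[of x k a b] by (intro add_mono) auto
      also have "\<dots> = ennreal ((q k + 2 / 3 * \<eta>) * (b - a))"
        using \<eta> ab q[of k] by (simp add: distrib_right flip: ennreal_mult ennreal_plus)
      also have "\<dots> \<le> ennreal (\<eta> * (b - a))"
        using k ab by (intro ennreal_leI mult_right_mono) auto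
      finally show ?thesis .
    qed
    then show "\<exists>r>0. \<forall>x a b. x \<notin> (\<Union>k. T k) \<longrightarrow> u \<le> a \<longrightarrow> a < b \<longrightarrow> b \<le> v \<longrightarrow> x \<in> {a..b} \<longrightarrow> b - a < r \<longrightarrow>
       (\<integral>\<^sup>+s\<in>{a..b}. ennreal (norm (f s - f x)) \<partial>lebesgue) \<le> ennreal (\<eta> * (b - a))"
      using r(1) by blast
  qed
qed

section \<open>Interpolation by horizontal curves\<close>

text \<open>
  The symplectic form on the horizontal layer. It is the form for which the group law reads
  \<open>t + t' + 2 * symp z z'\<close>, and a curve with horizontal part \<open>z\<close> and height \<open>\<theta>\<close> is horizontal exactly if
  \<open>\<theta>' = 2 * symp z z'\<close> almost everywhere.
\<close>

definition symp :: "(real ^ 'n::finite) \<times> (real ^ 'n) \<Rightarrow> (real ^ 'n) \<times> (real ^ 'n) \<Rightarrow> real" where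
  "symp z w = snd z \<bullet> fst w - fst z \<bullet> snd w"

lemma abs_symp_le: "\<bar>symp z w\<bar> \<le> norm z * norm w"
proof -
  have "symp z w = z \<bullet> (- snd w, fst w)"
    by (simp add: symp_def inner_prod_def)
  moreover have "norm (- snd w, fst w) = norm w"
    by (simp add: norm_prod_def add.commute)
  ultimately show ?thesis
    using Cauchy_Schwarz_ineq2[of z "(- snd w, fst w)"] by simp
qed

interpretation symp: bounded_bilinear symp
proof
  show "\<exists>K. \<forall>a b. norm (symp a b) \<le> norm a * norm b * K"
    using abs_symp_le by (intro exI[of _ 1]) auto
qed (auto simp: symp_def inner_left_distrib inner_right_distrib algebra_simps)

lemma symp_self [simp]: "symp z z = 0"
  by (simp add: symp_def inner_commute)

lemma continuous_on_symp [continuous_intros]: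
  "continuous_on A f \<Longrightarrow> continuous_on A g \<Longrightarrow> continuous_on A (\<lambda>x. symp (f x) (g x))"
  by (rule symp.continuous_on)

lemma has_vector_derivative_scaleR_const:
  assumes "(f has_real_derivative f') (at x within S)"
  shows "((\<lambda>x. f x *\<^sub>R c) has_vector_derivative f' *\<^sub>R c) (at x within S)"
  using has_vector_derivative_scaleR[OF assms has_vector_derivative_const[of c]] by simp

text \<open>
  The sign of the quadratic coefficient may be chosen to agree with that of the target, and the
  sign of \<open>\<delta>\<close> so that the linear term helps. Then the intermediate value theorem gives a solution whose
  size is controlled by \<open>\<beta>\<close> alone, whatever the linear coefficient is.
\<close>

lemma solve_signed_quadratic:
  fixes A \<beta> \<kappa> :: real
  assumes k: "\<kappa> > 0"
  shows "\<exists>\<delta>. \<delta> * A + \<delta>\<^sup>2 * ((if \<beta> \<ge> 0 then 1 else -1) * \<kappa>) = \<beta> \<and> \<kappa> * \<delta>\<^sup>2 \<le> \<bar>\<beta>\<bar>"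
proof -
  have pos: "\<exists>\<delta>. \<delta> * A + \<delta>\<^sup>2 * \<kappa> = \<beta> \<and> \<kappa> * \<delta>\<^sup>2 \<le> \<beta>" if b: "\<beta> \<ge> 0" for A \<beta>
  proof -
    define d where "d = (if A \<ge> 0 then 1 else -1) * sqrt (\<beta> / \<kappa>)"
    have d2: "d\<^sup>2 * \<kappa> = \<beta>" using b k by (simp add: d_def power_mult_distrib)
    have dA: "d * A \<ge> 0" using b k by (auto simp: d_def mult_nonneg_nonpos2 mult_nonneg_nonneg mult_le_0_iff)
    have "\<exists>t\<ge>0. t \<le> 1 \<and> t * (d * A) + t\<^sup>2 * (d\<^sup>2 * \<kappa>) = \<beta>"
      using b d2 dA by (intro IVT') (auto intro!: continuous_intros)
    then obtain t where t: "0 \<le> t" "t \<le> 1" "t * (d * A) + t\<^sup>2 * (d\<^sup>2 * \<kappa>) = \<beta>" by blast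
    have "t\<^sup>2 * (d\<^sup>2 * \<kappa>) \<le> 1 * \<beta>"
      unfolding d2 using t b by (intro mult_right_mono) (auto simp: power_le_one)
    then show ?thesis
      using t by (intro exI[of _ "t * d"]) (auto simp: power_mult_distrib mult_ac)
  qed
  show ?thesis
  proof (cases "\<beta> \<ge> 0")
    case True
    then show ?thesis using pos[of \<beta> A] by auto
  next
    case False
    then obtain \<delta> where "\<delta> * (- A) + \<delta>\<^sup>2 * \<kappa> = - \<beta>" "\<kappa> * \<delta>\<^sup>2 \<le> - \<beta>"
      using pos[of "- \<beta>" "- A"] by auto
    then show ?thesis using False by (intro exI[of _ \<delta>]) (auto simp: algebra_simps)
  qed
qed

text \<open>
  Here \<open>H\<close> is the size of the initial velocity, \<open>\<rho>\<close> the deviation of the final and the mean velocity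
  from it, and \<open>\<alpha>\<close> the area to be enclosed. The square root appears because the area enclosed by
  a loop is quadratic in the amplitude of the loop.
\<close>

definition interp_bound :: "real \<Rightarrow> real \<Rightarrow> real \<Rightarrow> real" where
  "interp_bound H \<rho> \<alpha> = 3 * \<rho> + 2 * sqrt (315 * (\<alpha> + 12 * H * \<rho> + 18 * \<rho>\<^sup>2))"

text \<open>
  A quadratic velocity \<open>u0\<close> meets the requirements on the end velocities and the displacement, but
  it encloses some area \<open>A0\<close> of its own instead of \<open>\<alpha>\<close>. Adding \<open>\<delta>\<close> times
  a closed loop \<open>W\<close>, which with its derivative vanishes at both ends, keeps these requirements and changes the area
  to \<open>A0 + \<delta> * A1 + \<delta>\<^sup>2 * A2\<close>, where \<open>A2\<close> is the nonzero area of the loop. The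
  quadratic term alone can produce any area, also if \<open>h0\<close> vanishes.
\<close>

lemma horizontal_unit_interpolant:
  fixes h0 h1 m :: "(real ^ 'n::finite) \<times> (real ^ 'n)" and \<alpha> :: real
  shows "\<exists>u U \<Theta>. continuous_on {0..1} u \<and>
    (\<forall>\<sigma>\<in>{0..1}. (U has_vector_derivative u \<sigma>) (at \<sigma> within {0..1}) \<and>
       (\<Theta> has_vector_derivative 2 * symp (U \<sigma>) (u \<sigma>)) (at \<sigma> within {0..1}) \<and>
       norm (u \<sigma> - h0) \<le> interp_bound (norm h0) (norm (h1 - h0) + norm (m - h0)) \<bar>\<alpha>\<bar>) \<and>
    u 0 = h0 \<and> u 1 = h1 \<and> U 0 = 0 \<and> U 1 = m \<and> \<Theta> 0 = (0::real) \<and> \<Theta> 1 = \<alpha>"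
proof -
  define \<rho> where "\<rho> = norm (h1 - h0) + norm (m - h0)"
  define c where "c = m - (1/2) *\<^sub>R (h0 + h1)"
  define e0 where "e0 \<sigma> = \<sigma> *\<^sub>R (h1 - h0) + (6 * \<sigma> * (1 - \<sigma>)) *\<^sub>R c" for \<sigma> :: real
  define E0 where "E0 \<sigma> = (\<sigma>\<^sup>2 / 2) *\<^sub>R (h1 - h0) + (3 * \<sigma>\<^sup>2 - 2 * \<sigma>^3) *\<^sub>R c" for \<sigma> :: real
  define u0 where "u0 \<sigma> = h0 + e0 \<sigma>" for \<sigma>
  define U0 where "U0 \<sigma> = \<sigma> *\<^sub>R h0 + E0 \<sigma>" for \<sigma>
  have \<rho>0: "\<rho> \<ge> 0" by (simp add: \<rho>_def)
  have cn: "norm c \<le> \<rho>"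
  proof -
    have "c = (m - h0) - (1/2) *\<^sub>R (h1 - h0)" by (simp add: c_def scaleR_2 algebra_simps flip: scaleR_add_left)
    then have "norm c \<le> norm (m - h0) + 1/2 * norm (h1 - h0)"
      using norm_triangle_ineq4[of "m - h0" "(1/2) *\<^sub>R (h1 - h0)"] by simp
    then show ?thesis using norm_ge_zero[of "h1 - h0"] unfolding \<rho>_def by linarith
  qed
  have hn: "norm (h1 - h0) \<le> \<rho>" by (simp add: \<rho>_def)
  have ss: "0 \<le> \<sigma> * (1 - \<sigma>) \<and> \<sigma> * (1 - \<sigma>) \<le> 1/4" if "\<sigma> \<in> {0..1}" for \<sigma> :: real
  proof -
    have "\<sigma> * (1 - \<sigma>) = 1/4 - (\<sigma> - 1/2)\<^sup>2" by (simp add: power2_eq_square algebra_simps)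
    moreover have "0 \<le> \<sigma> * (1 - \<sigma>)" using that by auto
    ultimately show ?thesis by auto
  qed
  have e0n: "norm (e0 \<sigma>) \<le> 3 * \<rho>" if s: "\<sigma> \<in> {0..1}" for \<sigma>
  proof -
    have "norm (e0 \<sigma>) \<le> \<bar>\<sigma>\<bar> * norm (h1 - h0) + \<bar>6 * \<sigma> * (1 - \<sigma>)\<bar> * norm c"
      unfolding e0_def by (rule order_trans[OF norm_triangle_ineq]) simp
    also have "\<dots> \<le> 1 * \<rho> + 2 * \<rho>"
      using s ss[OF s] hn cn \<rho>0 by (intro add_mono mult_mono) (auto simp: abs_le_iff)
    finally show ?thesis by simp
  qed
  have E0n: "norm (E0 \<sigma>) \<le> 3 * \<rho>" if s: "\<sigma> \<in> {0..1}" for \<sigma>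
  proof -
    have "norm (E0 \<sigma>) \<le> \<bar>\<sigma>\<^sup>2 / 2\<bar> * norm (h1 - h0) + \<bar>3 * \<sigma>\<^sup>2 - 2 * \<sigma>^3\<bar> * norm c"
      unfolding E0_def by (rule order_trans[OF norm_triangle_ineq]) simp
    also have "\<dots> \<le> 1 * \<rho> + 2 * \<rho>"
    proof -
      have b: "0 \<le> \<sigma>\<^sup>2" "\<sigma>\<^sup>2 \<le> 1" "0 \<le> \<sigma>^3" "\<sigma>^3 \<le> \<sigma>\<^sup>2"
        using s by (auto intro!: power_le_one power_decreasing)
      have "3 * \<sigma>\<^sup>2 - 2 * \<sigma>^3 \<le> 2"
      proof -
        have "1 - (3 * \<sigma>\<^sup>2 - 2 * \<sigma>^3) = (1 - \<sigma>)\<^sup>2 * (1 + 2 * \<sigma>)"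
          by (simp add: power2_eq_square power3_eq_cube algebra_simps)
        also have "\<dots> \<ge> 0" using s by auto
        finally show ?thesis by simp
      qed
      then have "\<bar>3 * \<sigma>\<^sup>2 - 2 * \<sigma>^3\<bar> \<le> 2" using b by linarith
      then show ?thesis by (intro add_mono mult_mono; use b hn cn \<rho>0 in \<open>linarith | simp\<close>)
    qed
    finally show ?thesis by simp
  qed
  have dU0: "(U0 has_vector_derivative u0 \<sigma>) (at \<sigma> within {0..1})" for \<sigma>
  proof -
    have "((\<lambda>\<sigma>. \<sigma>) has_real_derivative 1) (at \<sigma> within {0..1})" by simp
    moreover have "((\<lambda>\<sigma>. \<sigma>\<^sup>2 / 2) has_real_derivative \<sigma>) (at \<sigma> within {0..1})"
      by (auto intro!: derivative_eq_intros)
    moreover have "((\<lambda>\<sigma>. 3 * \<sigma>\<^sup>2 - 2 * \<sigma>^3) has_real_derivative 6 * \<sigma> * (1 - \<sigma>)) (at \<sigma> within {0..1})"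
      by (auto intro!: derivative_eq_intros simp: power2_eq_square algebra_simps)
    ultimately have "((\<lambda>\<sigma>. \<sigma> *\<^sub>R h0 + ((\<sigma>\<^sup>2 / 2) *\<^sub>R (h1 - h0) + (3 * \<sigma>\<^sup>2 - 2 * \<sigma>^3) *\<^sub>R c)) has_vector_derivative
        1 *\<^sub>R h0 + (\<sigma> *\<^sub>R (h1 - h0) + (6 * \<sigma> * (1 - \<sigma>)) *\<^sub>R c)) (at \<sigma> within {0..1})"
      by (intro has_vector_derivative_add has_vector_derivative_scaleR_const)
    then show ?thesis by (simp add: U0_def[abs_def] E0_def u0_def e0_def)
  qed
  have cu0: "continuous_on {0..1} u0" and cU0: "continuous_on {0..1} U0"
    unfolding u0_def e0_def U0_def E0_def by (intro continuous_intros; simp)+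
  have u0_ends: "u0 0 = h0" "u0 1 = h1" "U0 0 = 0" "U0 1 = m"
    by (simp_all add: u0_def e0_def U0_def E0_def c_def algebra_simps flip: scaleR_add_left)
  define A0 where "A0 = integral {0..1} (\<lambda>x. 2 * symp (U0 x) (u0 x))"
  have A0: "\<bar>A0\<bar> \<le> 12 * norm h0 * \<rho> + 18 * \<rho>\<^sup>2"
  proof -
    have "norm (2 * symp (U0 x) (u0 x)) \<le> 12 * norm h0 * \<rho> + 18 * \<rho>\<^sup>2" if x: "x \<in> {0..1}" for x
    proof -
      have eq: "symp (U0 x) (u0 x) = x * symp h0 (e0 x) + symp (E0 x) h0 + symp (E0 x) (e0 x)"
        by (simp add: U0_def u0_def symp.add_left symp.add_right symp.scaleR_left)
      have "\<bar>x * symp h0 (e0 x)\<bar> \<le> 1 * (norm h0 * (3 * \<rho>))"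
        unfolding abs_mult using x e0n[OF x] by (intro mult_mono order_trans[OF abs_symp_le] mult_left_mono) auto
      moreover have "\<bar>symp (E0 x) h0\<bar> \<le> 3 * \<rho> * norm h0"
        using E0n[OF x] by (intro order_trans[OF abs_symp_le] mult_right_mono) auto
      moreover have "\<bar>symp (E0 x) (e0 x)\<bar> \<le> (3 * \<rho>) * (3 * \<rho>)"
        using E0n[OF x] e0n[OF x] \<rho>0 by (intro order_trans[OF abs_symp_le] mult_mono) auto
      ultimately have "\<bar>symp (U0 x) (u0 x)\<bar> \<le> norm h0 * (3 * \<rho>) + 3 * \<rho> * norm h0 + (3 * \<rho>) * (3 * \<rho>)"
        unfolding eq by linarith
      then show ?thesis by (simp add: power2_eq_square algebra_simps)
    qed
    then have "norm A0 \<le> (12 * norm h0 * \<rho> + 18 * \<rho>\<^sup>2) * (1 - 0)"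
      unfolding A0_def using cu0 cU0 by (intro integral_bound continuous_intros) auto
    then show ?thesis by simp
  qed
  \<comment> \<open>\<open>e\<close> and \<open>e'\<close> span a symplectic plane; \<open>s\<close> orients the loop in it so that its area has the sign of \<open>\<alpha> - A0\<close>.\<close>
  define s :: real where "s = (if \<alpha> - A0 \<ge> 0 then -1 else 1)"
  define e :: "(real ^ 'n) \<times> (real ^ 'n)" where "e = (axis undefined 1, 0)"
  define e' :: "(real ^ 'n) \<times> (real ^ 'n)" where "e' = (0, axis undefined 1)"
  have ee: "symp e e' = -1" "symp e' e = 1" by (simp_all add: symp_def e_def e'_def inner_axis_axis)
  have en: "norm e = 1" "norm e' = 1" by (simp_all add: e_def e'_def norm_Pair)
  have s1: "\<bar>s\<bar> = 1" by (simp add: s_def)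
  define w where "w \<sigma> = (2 * \<sigma> * (1 - \<sigma>) * (1 - 2 * \<sigma>)) *\<^sub>R e + (s * (\<sigma>\<^sup>2 * (1 - \<sigma>) * (3 - 5 * \<sigma>))) *\<^sub>R e'" for \<sigma> :: real
  define W where "W \<sigma> = (\<sigma>\<^sup>2 * (1 - \<sigma>)\<^sup>2) *\<^sub>R e + (s * (\<sigma>^3 * (1 - \<sigma>)\<^sup>2)) *\<^sub>R e'" for \<sigma> :: real
  have dW: "(W has_vector_derivative w \<sigma>) (at \<sigma> within {0..1})" for \<sigma>
  proof -
    have "((\<lambda>\<sigma>. \<sigma>\<^sup>2 * (1 - \<sigma>)\<^sup>2) has_real_derivative 2 * \<sigma> * (1 - \<sigma>) * (1 - 2 * \<sigma>)) (at \<sigma> within {0..1})"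
      by (rule derivative_eq_intros refl | simp)+ (simp add: power2_eq_square algebra_simps)
    moreover have "((\<lambda>\<sigma>. s * (\<sigma>^3 * (1 - \<sigma>)\<^sup>2)) has_real_derivative s * (\<sigma>\<^sup>2 * (1 - \<sigma>) * (3 - 5 * \<sigma>))) (at \<sigma> within {0..1})"
      by (rule derivative_eq_intros refl | simp)+ (simp add: power2_eq_square power3_eq_cube algebra_simps)
    ultimately show ?thesis
      unfolding W_def w_def by (intro has_vector_derivative_add has_vector_derivative_scaleR_const)
  qed
  have cw: "continuous_on {0..1} w" and cW: "continuous_on {0..1} W"
    unfolding w_def W_def by (intro continuous_intros; simp)+
  have W_ends: "w 0 = 0" "w 1 = 0" "W 0 = 0" "W 1 = 0"
    by (simp_all add: w_def W_def)
  have wn: "norm (w \<sigma>) \<le> 2" if x: "\<sigma> \<in> {0..1}" for \<sigma>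
  proof -
    have "\<bar>\<sigma> * (1 - \<sigma>)\<bar> * \<bar>1 - 2 * \<sigma>\<bar> \<le> 1/4 * 1"
      using x ss[OF x] by (intro mult_mono) auto
    then have 1: "\<bar>2 * \<sigma> * (1 - \<sigma>) * (1 - 2 * \<sigma>)\<bar> \<le> 1"
      unfolding abs_mult by simp
    have "\<bar>\<sigma>\<bar> * (\<bar>\<sigma> * (1 - \<sigma>)\<bar> * \<bar>3 - 5 * \<sigma>\<bar>) \<le> 1 * (1/4 * 3)"
      using x ss[OF x] by (intro mult_mono) auto
    then have 2: "\<bar>\<sigma>\<^sup>2 * (1 - \<sigma>) * (3 - 5 * \<sigma>)\<bar> \<le> 1"
      unfolding abs_mult power2_eq_square by (simp add: mult_ac)
    have "norm (w \<sigma>) \<le> \<bar>2 * \<sigma> * (1 - \<sigma>) * (1 - 2 * \<sigma>)\<bar> * norm e + \<bar>s * (\<sigma>\<^sup>2 * (1 - \<sigma>) * (3 - 5 * \<sigma>))\<bar> * norm e'"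
      unfolding w_def by (rule order_trans[OF norm_triangle_ineq]) simp
    also have "\<dots> \<le> 1 + 1" unfolding abs_mult[of s] en s1 using 1 2 by simp
    finally show ?thesis by simp
  qed
  define A1 where "A1 = integral {0..1} (\<lambda>x. 2 * symp (U0 x) (w x) + 2 * symp (W x) (u0 x))"
  \<comment> \<open>The integrand is a multiple of \<open>F\<^sup>2\<close> for \<open>F x = x\<^sup>2 * (1 - x)\<^sup>2\<close>, since the components of \<open>W\<close> are\<close>
  \<comment> \<open>\<open>F\<close> and \<open>s * x * F x\<close>; and \<open>F\<^sup>2\<close> has integral \<open>1 / 630\<close>.\<close>
  have A2: "((\<lambda>x. 2 * symp (W x) (w x)) has_integral (- s / 315)) {0..1}"
  proof -
    have eq: "2 * symp (W x) (w x) = - 2 * s * (x^4 * (1 - x)^4)" for x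
    proof -
      have "symp (W x) (w x) = - (x\<^sup>2 * (1 - x)\<^sup>2) * (s * (x\<^sup>2 * (1 - x) * (3 - 5 * x)))
          + (s * (x^3 * (1 - x)\<^sup>2)) * (2 * x * (1 - x) * (1 - 2 * x))"
        unfolding W_def w_def
        by (simp add: symp.add_left symp.add_right symp.scaleR_left symp.scaleR_right ee)
      also have "\<dots> = - s * (x^4 * (1 - x)^4)" by algebra
      finally show ?thesis by simp
    qed
    define P where "P x = - 2 * s * (x^5 / 5 - 4 * x^6 / 6 + 6 * x^7 / 7 - 4 * x^8 / 8 + x^9 / 9)" for x :: real
    have "(P has_vector_derivative 2 * symp (W x) (w x)) (at x within {0..1})" for x
    proof -
      have "(P has_real_derivative 2 * symp (W x) (w x)) (at x within {0..1})"
        unfolding P_def eq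
        by (rule derivative_eq_intros refl | simp)+ algebra
      then show ?thesis by (simp add: has_real_derivative_iff_has_vector_derivative)
    qed
    then have "((\<lambda>x. 2 * symp (W x) (w x)) has_integral (P 1 - P 0)) {0..1}"
      by (intro fundamental_theorem_of_calculus) auto
    then show ?thesis by (simp add: P_def)
  qed
  obtain \<delta> where \<delta>: "\<delta> * A1 + \<delta>\<^sup>2 * (- s / 315) = \<alpha> - A0" "1 / 315 * \<delta>\<^sup>2 \<le> \<bar>\<alpha> - A0\<bar>"
    using solve_signed_quadratic[of "1/315" A1 "\<alpha> - A0"] by (auto simp: s_def split: if_splits)
  have \<delta>n: "\<bar>\<delta>\<bar> \<le> sqrt (315 * (\<bar>\<alpha>\<bar> + 12 * norm h0 * \<rho> + 18 * \<rho>\<^sup>2))"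
  proof (rule real_le_rsqrt)
    have "\<bar>\<delta>\<bar>\<^sup>2 \<le> 315 * \<bar>\<alpha> - A0\<bar>" using \<delta>(2) by simp
    also have "\<dots> \<le> 315 * (\<bar>\<alpha>\<bar> + 12 * norm h0 * \<rho> + 18 * \<rho>\<^sup>2)"
      using A0 by (intro mult_left_mono) linarith+
    finally show "\<bar>\<delta>\<bar>\<^sup>2 \<le> 315 * (\<bar>\<alpha>\<bar> + 12 * norm h0 * \<rho> + 18 * \<rho>\<^sup>2)" .
  qed
  define u where "u \<sigma> = u0 \<sigma> + \<delta> *\<^sub>R w \<sigma>" for \<sigma>
  define U where "U \<sigma> = U0 \<sigma> + \<delta> *\<^sub>R W \<sigma>" for \<sigma>
  define \<Theta> where "\<Theta> \<sigma> = integral {0..\<sigma>} (\<lambda>x. 2 * symp (U x) (u x))" for \<sigma>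
  have cu: "continuous_on {0..1} u" and cU: "continuous_on {0..1} U"
    unfolding u_def U_def using cu0 cU0 cw cW by (intro continuous_intros; simp)+
  have dU: "(U has_vector_derivative u \<sigma>) (at \<sigma> within {0..1})" for \<sigma>
    unfolding U_def u_def
    by (intro has_vector_derivative_add dU0 bounded_linear.has_vector_derivative[OF bounded_linear_scaleR_right] dW)
  have d\<Theta>: "(\<Theta> has_vector_derivative 2 * symp (U \<sigma>) (u \<sigma>)) (at \<sigma> within {0..1})" if "\<sigma> \<in> {0..1}" for \<sigma>
    unfolding \<Theta>_def using that cu cU
    by (intro integral_has_vector_derivative continuous_intros) auto
  have "\<Theta> 1 = \<alpha>"
  proof -
    have "((\<lambda>x. 2 * symp (U0 x) (u0 x)) has_integral A0) {0..1}"
      unfolding A0_def using cu0 cU0 by (intro integrable_integral integrable_continuous_real continuous_intros)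
    moreover have "((\<lambda>x. 2 * symp (U0 x) (w x) + 2 * symp (W x) (u0 x)) has_integral A1) {0..1}"
      unfolding A1_def using cu0 cU0 cw cW by (intro integrable_integral integrable_continuous_real continuous_intros)
    ultimately have "((\<lambda>x. 2 * symp (U0 x) (u0 x) + \<delta> * (2 * symp (U0 x) (w x) + 2 * symp (W x) (u0 x)) + \<delta>\<^sup>2 * (2 * symp (W x) (w x)))
        has_integral (A0 + \<delta> * A1 + \<delta>\<^sup>2 * (- s / 315))) {0..1}"
      by (intro has_integral_add has_integral_mult_right A2)
    moreover have "2 * symp (U0 x) (u0 x) + \<delta> * (2 * symp (U0 x) (w x) + 2 * symp (W x) (u0 x)) + \<delta>\<^sup>2 * (2 * symp (W x) (w x))
        = 2 * symp (U x) (u x)" for x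
      by (simp add: U_def u_def symp.add_left symp.add_right symp.scaleR_left symp.scaleR_right power2_eq_square algebra_simps)
    ultimately show ?thesis unfolding \<Theta>_def using \<delta>(1) by (auto dest: integral_unique)
  qed
  moreover have "norm (u \<sigma> - h0) \<le> interp_bound (norm h0) \<rho> \<bar>\<alpha>\<bar>" if x: "\<sigma> \<in> {0..1}" for \<sigma>
  proof -
    have "u \<sigma> - h0 = e0 \<sigma> + \<delta> *\<^sub>R w \<sigma>" by (simp add: u_def u0_def)
    then have "norm (u \<sigma> - h0) \<le> norm (e0 \<sigma>) + \<bar>\<delta>\<bar> * norm (w \<sigma>)"
      using norm_triangle_ineq[of "e0 \<sigma>" "\<delta> *\<^sub>R w \<sigma>"] by simp
    also have "\<dots> \<le> 3 * \<rho> + sqrt (315 * (\<bar>\<alpha>\<bar> + 12 * norm h0 * \<rho> + 18 * \<rho>\<^sup>2)) * 2"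
      using e0n[OF x] wn[OF x] \<delta>n order_trans[OF abs_ge_zero \<delta>n] by (intro add_mono mult_mono) simp_all
    finally show ?thesis by (simp add: interp_bound_def)
  qed
  ultimately show ?thesis
    using cu dU d\<Theta> u0_ends W_ends unfolding \<rho>_def[symmetric]
    by (intro exI[of _ u] exI[of _ U] exI[of _ \<Theta>]) (auto simp: u_def U_def \<Theta>_def)
qed

section \<open>Gluing along the complement of a compact set\<close>

lemma complementary_gap:
  fixes K :: "real set"
  assumes "compact K" "a0 \<in> K" "b0 \<in> K" "a0 \<le> t" "t \<le> b0" "t \<notin> K"
  obtains a b where "a \<in> K" "b \<in> K" "a < t" "t < b" "K \<inter> {a<..<b} = {}"
proof -
  have A: "compact (K \<inter> {..t})" "K \<inter> {..t} \<noteq> {}"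
    and B: "compact (K \<inter> {t..})" "K \<inter> {t..} \<noteq> {}"
    using assms by (auto intro: compact_Int_closed)
  obtain a where a: "a \<in> K \<inter> {..t}" "\<forall>x\<in>K \<inter> {..t}. x \<le> a"
    using compact_attains_sup[OF A] by blast
  obtain b where b: "b \<in> K \<inter> {t..}" "\<forall>x\<in>K \<inter> {t..}. b \<le> x"
    using compact_attains_inf[OF B] by blast
  have "a \<noteq> t" "b \<noteq> t" using a(1) b(1) assms(6) by auto
  moreover have "K \<inter> {a<..<b} = {}"
  proof (rule equals0I)
    fix x assume "x \<in> K \<inter> {a<..<b}"
    then show False using a(2) b(2) by (cases "x \<le> t") force+
  qed
  ultimately show ?thesis using a(1) b(1) by (intro that[of a b]) auto
qed

lemma vector_derivative_increment_bound:
  fixes G :: "real \<Rightarrow> 'a::real_normed_vector"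
  assumes "a \<le> b"
    and G: "\<And>s. s \<in> {a..b} \<Longrightarrow> (G has_vector_derivative D s) (at s within {a..b})"
    and D: "\<And>s. s \<in> {a..b} \<Longrightarrow> norm (D s - c) \<le> e"
  shows "norm (G b - G a - (b - a) *\<^sub>R c) \<le> e * (b - a)"
proof -
  have "norm ((\<lambda>s. G s - s *\<^sub>R c) b - (\<lambda>s. G s - s *\<^sub>R c) a) \<le> e * norm (b - a)"
  proof (rule differentiable_bound[of "{a..b}" _ "\<lambda>s h. h *\<^sub>R (D s - c)"])
    fix s assume s: "s \<in> {a..b}"
    have "((\<lambda>s. G s - s *\<^sub>R c) has_vector_derivative D s - 1 *\<^sub>R c) (at s within {a..b})"
      using s by (intro has_vector_derivative_diff G has_vector_derivative_scaleR_const) auto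
    then show "((\<lambda>s. G s - s *\<^sub>R c) has_derivative (\<lambda>h. h *\<^sub>R (D s - c))) (at s within {a..b})"
      by (simp add: has_vector_derivative_def)
    show "onorm (\<lambda>h. h *\<^sub>R (D s - c)) \<le> e"
      using D[OF s] by (intro onorm_le) (metis abs_ge_zero mult.commute mult_left_mono norm_scaleR real_norm_def)
  qed (use assms(1) in auto)
  then show ?thesis using assms(1) by (simp add: algebra_simps)
qed

text \<open>
  A point near \<open>t\<close> is reached from \<open>t\<close> by first moving within \<open>K\<close> to the near end of its gap and then
  inside the gap. The first increment is controlled by the derivative within \<open>K\<close>, the second by
  the mean value inequality and the continuity of \<open>D\<close>.
\<close>

lemma has_vector_derivative_glue:
  fixes G :: "real \<Rightarrow> 'a::real_normed_vector"
  assumes K: "compact K" "K \<subseteq> {0..1}" "0 \<in> K" "1 \<in> K"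
    and D: "continuous_on {0..1} D"
    and gap: "\<And>a b t. a \<in> K \<Longrightarrow> b \<in> K \<Longrightarrow> a < b \<Longrightarrow> K \<inter> {a<..<b} = {} \<Longrightarrow> t \<in> {a..b} \<Longrightarrow>
        (G has_vector_derivative D t) (at t within {a..b})"
    and dK: "\<And>k. k \<in> K \<Longrightarrow> (G has_vector_derivative D k) (at k within K)"
    and t: "t \<in> {0..1}"
  shows "(G has_vector_derivative D t) (at t within {0..1})"
proof (cases "t \<in> K")
  case False
  obtain a b where ab: "a \<in> K" "b \<in> K" "a < t" "t < b" "K \<inter> {a<..<b} = {}"
    using complementary_gap[OF K(1,3,4)] t False by auto
  have "(G has_vector_derivative D t) (at t within {a..b})" using ab by (intro gap) auto
  moreover have "at t within {a..b} = at t" using ab by (intro at_within_interior) auto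
  ultimately show ?thesis by (auto intro: has_vector_derivative_at_within)
next
  case True
  have "\<exists>d>0. \<forall>y\<in>{0..1}. norm (y - t) < d \<longrightarrow> norm (G y - G t - (y - t) *\<^sub>R D t) \<le> e * norm (y - t)"
    if e: "e > 0" for e
  proof -
    obtain d1 where d1: "d1 > 0"
        "\<And>y. y \<in> K \<Longrightarrow> norm (y - t) < d1 \<Longrightarrow> norm (G y - G t - (y - t) *\<^sub>R D t) \<le> e * norm (y - t)"
      using dK[OF True] e unfolding has_vector_derivative_def has_derivative_within_alt by meson
    obtain d2 where d2: "d2 > 0" "\<And>y. y \<in> {0..1} \<Longrightarrow> norm (y - t) < d2 \<Longrightarrow> norm (D y - D t) \<le> e"
      using D t e unfolding continuous_on_iff dist_norm by (meson less_imp_le)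
    have "norm (G y - G t - (y - t) *\<^sub>R D t) \<le> e * norm (y - t)"
      if y: "y \<in> {0..1}" "norm (y - t) < min d1 d2" for y
    proof (cases "y \<in> K")
      case False
      obtain a b where ab: "a \<in> K" "b \<in> K" "a < y" "y < b" "K \<inter> {a<..<b} = {}"
        using complementary_gap[OF K(1,3,4)] y False by auto
      have ab01: "0 \<le> a" "b \<le> 1" using ab K(2) by auto
      have sub: "(G has_vector_derivative D s) (at s within {c..d})"
        if "a \<le> c" "d \<le> b" "s \<in> {c..d}" for c d s
        using that ab by (intro has_vector_derivative_within_subset[OF gap[of a b s]]) auto
      show ?thesis
      proof (cases "t \<le> a")
        case True
        have "norm (G y - G a - (y - a) *\<^sub>R D t) \<le> e * (y - a)"
          using ab y True ab01 t by (intro vector_derivative_increment_bound[where D = D] sub d2(2)) auto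
        moreover have "norm (G a - G t - (a - t) *\<^sub>R D t) \<le> e * (a - t)"
          using d1(2)[of a] ab True y by auto
        moreover have "G y - G t - (y - t) *\<^sub>R D t = (G y - G a - (y - a) *\<^sub>R D t) + (G a - G t - (a - t) *\<^sub>R D t)"
          by (simp add: algebra_simps)
        ultimately have "norm (G y - G t - (y - t) *\<^sub>R D t) \<le> e * (y - a) + e * (a - t)"
          by (metis add_mono norm_triangle_le)
        then show ?thesis using True ab by (simp add: algebra_simps)
      next
        case False
        then have bt: "b \<le> t" using ab \<open>t \<in> K\<close> by force
        have "norm (G b - G y - (b - y) *\<^sub>R D t) \<le> e * (b - y)"
          using ab y bt ab01 t by (intro vector_derivative_increment_bound[where D = D] sub d2(2)) auto
        moreover have "norm (G b - G t - (b - t) *\<^sub>R D t) \<le> e * (t - b)"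
          using d1(2)[of b] ab bt y by auto
        moreover have "G y - G t - (y - t) *\<^sub>R D t = (G b - G t - (b - t) *\<^sub>R D t) - (G b - G y - (b - y) *\<^sub>R D t)"
          by (simp add: algebra_simps)
        ultimately have "norm (G y - G t - (y - t) *\<^sub>R D t) \<le> e * (t - b) + e * (b - y)"
          by (metis add_mono norm_triangle_le_diff)
        then show ?thesis using bt ab by (simp add: algebra_simps)
      qed
    qed (use y d1 in auto)
    then show ?thesis using d1(1) d2(1) by (intro exI[of _ "min d1 d2"]) auto
  qed
  then show ?thesis
    unfolding has_vector_derivative_def has_derivative_within_alt
    by (auto intro: bounded_linear_scaleR_left)
qed

text \<open>
  Let \<open>k \<in> K\<close>. If \<open>k\<close> is an end of a gap on one side, continuity from that side is continuity on
  the closed gap. Otherwise points of \<open>K\<close> accumulate at \<open>k\<close> from that side, so all gaps nearby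
  are short and \<open>osc\<close> says that \<open>v\<close> hardly changes on them.
\<close>

lemma continuous_on_glue:
  fixes v :: "real \<Rightarrow> 'a::real_normed_vector"
  assumes K: "compact K" "K \<subseteq> {0..1}" "0 \<in> K" "1 \<in> K"
    and vK: "continuous_on K v"
    and gap: "\<And>a b. a \<in> K \<Longrightarrow> b \<in> K \<Longrightarrow> a < b \<Longrightarrow> K \<inter> {a<..<b} = {} \<Longrightarrow> continuous_on {a..b} v"
    and osc: "\<And>\<eta>. \<eta> > 0 \<Longrightarrow> \<exists>r>0. \<forall>a\<in>K. \<forall>b\<in>K. \<forall>t. K \<inter> {a<..<b} = {} \<longrightarrow> a < t \<longrightarrow> t < b \<longrightarrow> b - a < r \<longrightarrow>
        norm (v t - v a) \<le> \<eta>"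
  shows "continuous_on {0..1} v"
  unfolding continuous_on_eq_continuous_within
proof
  fix k :: real assume k: "k \<in> {0..1}"
  show "continuous (at k within {0..1}) v"
  proof (cases "k \<in> K")
    case False
    obtain a b where ab: "a \<in> K" "b \<in> K" "a < k" "k < b" "K \<inter> {a<..<b} = {}"
      using complementary_gap[OF K(1,3,4)] k False by auto
    have "continuous (at k within {a..b}) v"
      using gap[of a b] ab by (auto simp: continuous_on_eq_continuous_within)
    moreover have "at k within {a..b} = at k" using ab by (intro at_within_interior) auto
    ultimately show ?thesis by (auto intro: continuous_at_imp_continuous_within)
  next
    case True
    have "\<exists>d>0. \<forall>t\<in>{0..1}. dist t k < d \<longrightarrow> dist (v t) (v k) < \<eta>" if \<eta>: "\<eta> > 0" for \<eta>
    proof -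
      have \<eta>3: "\<eta> / 3 > 0" using \<eta> by simp
      from osc[OF \<eta>3] obtain r where r: "r > 0" "\<And>a b t. a \<in> K \<Longrightarrow> b \<in> K \<Longrightarrow> K \<inter> {a<..<b} = {} \<Longrightarrow> a < t \<Longrightarrow> t < b \<Longrightarrow> b - a < r \<Longrightarrow>
          norm (v t - v a) \<le> \<eta> / 3"
        by blast
      have "\<exists>d>0. \<forall>x\<in>K. dist x k < d \<longrightarrow> dist (v x) (v k) < \<eta> / 3"
        using vK True \<eta>3 unfolding continuous_on_iff by blast
      then obtain dK where dK: "dK > 0" "\<And>x. x \<in> K \<Longrightarrow> dist x k < dK \<Longrightarrow> dist (v x) (v k) < \<eta> / 3"
        by blast
      \<comment> \<open>Between two close points of \<open>K\<close> all gaps are short.\<close>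
      have between: "dist (v t) (v k) < \<eta>"
        if bet: "k1 \<in> K" "k2 \<in> K" "k1 \<le> t" "t \<le> k2" "k - dK < k1" "k2 < k + dK" "k2 - k1 < r" for t k1 k2
      proof (cases "t \<in> K")
        case True
        then have "dist (v t) (v k) < \<eta> / 3" using that by (intro dK(2)) (auto simp: dist_real_def)
        then show ?thesis using \<eta> by linarith
      next
        case False
        obtain a b where ab: "a \<in> K" "b \<in> K" "a < t" "t < b" "K \<inter> {a<..<b} = {}"
          using complementary_gap[OF K(1) bet(1,2,3,4) False] by blast
        have "k1 \<le> a"
        proof (rule ccontr)
          assume "\<not> ?thesis" then have "k1 \<in> K \<inter> {a<..<b}" using that ab by auto
          then show False using ab by auto
        qed
        moreover have "b \<le> k2"
        proof (rule ccontr)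
          assume "\<not> ?thesis" then have "k2 \<in> K \<inter> {a<..<b}" using that ab by auto
          then show False using ab by auto
        qed
        moreover from calculation have "dist (v a) (v k) < \<eta> / 3"
          using bet ab by (intro dK(2)) (auto simp: dist_real_def)
        moreover from calculation have "norm (v t - v a) \<le> \<eta> / 3"
          using bet ab by (intro r(2)[of a b]) auto
        ultimately show ?thesis using dist_triangle[of "v t" "v k" "v a"] \<eta> by (simp add: dist_norm)
      qed
      \<comment> \<open>Continuity from the right; below, continuity from the left is symmetric.\<close>
      have R: "\<exists>d>0. \<forall>t\<in>{0..1}. k \<le> t \<and> t < k + d \<longrightarrow> dist (v t) (v k) < \<eta>"
      proof (cases "\<exists>k'\<in>K. k < k' \<and> k' < k + min r dK")
        case True
        then obtain k' where k': "k' \<in> K" "k < k'" "k' < k + min r dK" by blast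
        have "dist (v t) (v k) < \<eta>" if "k \<le> t" "t < k + (k' - k)" for t
          using that k' \<open>k \<in> K\<close> dK(1) by (intro between[of k k']) auto
        then show ?thesis using k' by (intro exI[of _ "k' - k"]) auto
      next
        case no: False
        show ?thesis
        proof (cases "k = 1")
          case True
          then show ?thesis using \<eta> by (intro exI[of _ 1]) auto
        next
          case False
          define q where "q = min (min r dK) (1 - k)"
          have q: "q > 0" "q \<le> min r dK" "q \<le> 1 - k" using r(1) dK(1) False k by (auto simp: q_def)
          define s where "s = k + q / 2"
          have s: "k < s" "s < 1" "s < k + min r dK" using q unfolding s_def by linarith+
          have "s \<notin> K" using no s by auto
          then obtain a b where ab: "a \<in> K" "b \<in> K" "a < s" "s < b" "K \<inter> {a<..<b} = {}"
            using complementary_gap[OF K(1) \<open>k \<in> K\<close> K(4), of s] s by auto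
          have "k \<le> a"
          proof (rule ccontr)
            assume "\<not> ?thesis" then have "k \<in> K \<inter> {a<..<b}" using \<open>k \<in> K\<close> ab s by auto
            then show False using ab by auto
          qed
          moreover have "\<not> k < a" using no ab s by auto
          ultimately have "a = k" by simp
          then have "continuous_on {k..b} v" using gap[of k b] ab by auto
          moreover have "k \<in> {k..b}" using ab \<open>a = k\<close> by auto
          ultimately have "\<exists>d>0. \<forall>t\<in>{k..b}. dist t k < d \<longrightarrow> dist (v t) (v k) < \<eta>"
            using \<eta> unfolding continuous_on_iff by blast
          then obtain d where "d > 0" "\<And>t. t \<in> {k..b} \<Longrightarrow> dist t k < d \<Longrightarrow> dist (v t) (v k) < \<eta>"
            by blast
          then show ?thesis using ab \<open>a = k\<close>
            by (intro exI[of _ "min d (b - k)"]) (auto simp: dist_real_def)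
        qed
      qed
      have L: "\<exists>d>0. \<forall>t\<in>{0..1}. t \<le> k \<and> k - d < t \<longrightarrow> dist (v t) (v k) < \<eta>"
      proof (cases "\<exists>k'\<in>K. k' < k \<and> k - min r dK < k'")
        case True
        then obtain k' where k': "k' \<in> K" "k' < k" "k - min r dK < k'" by blast
        have "dist (v t) (v k) < \<eta>" if "t \<le> k" "k - (k - k') < t" for t
          using that k' \<open>k \<in> K\<close> dK(1) by (intro between[of k' k]) auto
        then show ?thesis using k' by (intro exI[of _ "k - k'"]) auto
      next
        case no: False
        show ?thesis
        proof (cases "k = 0")
          case True
          then show ?thesis using \<eta> by (intro exI[of _ 1]) auto
        next
          case False
          define q where "q = min (min r dK) k"
          have q: "q > 0" "q \<le> min r dK" "q \<le> k" using r(1) dK(1) False k by (auto simp: q_def)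
          define s where "s = k - q / 2"
          have s: "s < k" "0 < s" "k - min r dK < s" using q unfolding s_def by linarith+
          have "s \<notin> K" using no s by auto
          then obtain a b where ab: "a \<in> K" "b \<in> K" "a < s" "s < b" "K \<inter> {a<..<b} = {}"
            using complementary_gap[OF K(1,3) \<open>k \<in> K\<close>, of s] s by auto
          have "b \<le> k"
          proof (rule ccontr)
            assume "\<not> ?thesis" then have "k \<in> K \<inter> {a<..<b}" using \<open>k \<in> K\<close> ab s by auto
            then show False using ab by auto
          qed
          moreover have "\<not> b < k" using no ab s by auto
          ultimately have "b = k" by simp
          then have "continuous_on {a..k} v" using gap[of a k] ab by auto
          moreover have "k \<in> {a..k}" using ab \<open>b = k\<close> by auto
          ultimately have "\<exists>d>0. \<forall>t\<in>{a..k}. dist t k < d \<longrightarrow> dist (v t) (v k) < \<eta>"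
            using \<eta> unfolding continuous_on_iff by blast
          then obtain d where "d > 0" "\<And>t. t \<in> {a..k} \<Longrightarrow> dist t k < d \<Longrightarrow> dist (v t) (v k) < \<eta>"
            by blast
          then show ?thesis using ab \<open>b = k\<close>
            by (intro exI[of _ "min d (k - a)"]) (auto simp: dist_real_def)
        qed
      qed
      obtain dr where dr: "dr > 0" "\<And>t. t \<in> {0..1} \<Longrightarrow> k \<le> t \<Longrightarrow> t < k + dr \<Longrightarrow> dist (v t) (v k) < \<eta>"
        using R by blast
      obtain dl where dl: "dl > 0" "\<And>t. t \<in> {0..1} \<Longrightarrow> t \<le> k \<Longrightarrow> k - dl < t \<Longrightarrow> dist (v t) (v k) < \<eta>"
        using L by blast
      have "dist (v t) (v k) < \<eta>" if "t \<in> {0..1}" "dist t k < min dr dl" for t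
        using that by (cases "k \<le> t") (auto intro: dr(2) dl(2) simp: dist_real_def)
      then show ?thesis using dr(1) dl(1) by (intro exI[of _ "min dr dl"]) auto
    qed
    then show ?thesis unfolding continuous_within_eps_delta by blast
  qed
qed

section \<open>Whitney extension of horizontal curves\<close>

text \<open>
  This recovers the gap around a point as a function of the point, which makes the gapwise
  constructions below into a definition of one curve.
\<close>

lemma gap_endpoints_unique:
  fixes K :: "real set"
  assumes "a \<in> K" "b \<in> K" "K \<inter> {a<..<b} = {}" "a < t" "t < b"
  shows "Sup (K \<inter> {..t}) = a" "Inf (K \<inter> {t..}) = b"
proof -
  show "Sup (K \<inter> {..t}) = a"
  proof (rule cSup_eq_maximum)
    fix x assume "x \<in> K \<inter> {..t}"
    then have "x \<in> K" "x < b" "x \<notin> {a<..<b}" using assms by auto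
    then show "x \<le> a" by auto
  qed (use assms in auto)
  show "Inf (K \<inter> {t..}) = b"
  proof (rule cInf_eq_minimum)
    fix x assume "x \<in> K \<inter> {t..}"
    then have "x \<in> K" "a < x" "x \<notin> {a<..<b}" using assms by auto
    then show "b \<le> x" by auto
  qed (use assms in auto)
qed

lemma interp_bound_small:
  assumes "\<eta> > 0"
  shows "\<exists>\<delta>>0. \<forall>H \<rho> \<alpha>. 0 \<le> H \<longrightarrow> H \<le> M \<longrightarrow> 0 \<le> \<rho> \<longrightarrow> \<rho> \<le> \<delta> \<longrightarrow> \<alpha> \<le> \<delta> \<longrightarrow> interp_bound H \<rho> \<alpha> \<le> \<eta>"
proof -
  have "((\<lambda>d. interp_bound \<bar>M\<bar> d d) \<longlongrightarrow> 0) (at_right 0)"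
    unfolding interp_bound_def by (auto intro!: tendsto_eq_intros)
  then have "\<forall>\<^sub>F d in at_right 0. interp_bound \<bar>M\<bar> d d < \<eta>"
    using assms by (rule order_tendstoD)
  then have "\<forall>\<^sub>F d in at_right (0::real). interp_bound \<bar>M\<bar> d d < \<eta> \<and> d \<in> {0<..<1}"
    by (intro eventually_conj eventually_at_right_real) auto
  from eventually_happens'[OF _ this] obtain d where d: "d > 0" "interp_bound \<bar>M\<bar> d d < \<eta>"
    by auto
  have "interp_bound H \<rho> \<alpha> \<le> interp_bound \<bar>M\<bar> d d" if "0 \<le> H" "H \<le> M" "0 \<le> \<rho>" "\<rho> \<le> d" "\<alpha> \<le> d" for H \<rho> \<alpha>
  proof -
    have "12 * H * \<rho> \<le> 12 * \<bar>M\<bar> * d" using that by (intro mult_mono) auto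
    moreover have "\<rho>\<^sup>2 \<le> d\<^sup>2" using that by (intro power_mono) auto
    ultimately show ?thesis unfolding interp_bound_def
      using that by (intro add_mono mult_left_mono real_sqrt_le_mono) auto
  qed
  then show ?thesis using d by (intro exI[of _ d]) fastforce
qed

text \<open>
  A Whitney extension theorem for horizontal curves: data on the compact set \<open>K\<close> extend to a \<open>C\<^sup>1\<close>
  horizontal curve if, uniformly, the horizontal increments are of first order given by \<open>h\<close> and the
  height of \<open>(p a, \<tau> a)\<^sup>-\<^sup>1 (p b, \<tau> b)\<close>, which is \<open>\<tau> b - \<tau> a - 2 * symp (p a) (p b)\<close>, is of smaller order than
  \<open>(b - a)\<^sup>2\<close>.

  In a gap \<open>(a, b)\<close> the curve is the left translate by the point over \<open>a\<close> of the rescaled unit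
  interpolant. A rescaling by \<open>b - a\<close> in the horizontal directions is a rescaling by \<open>(b - a)\<^sup>2\<close> of
  heights, so the area \<open>\<alpha> a b\<close> required on the unit interval tends to 0 with the length of the
  gap. Hence the velocities in short gaps are close to \<open>h a\<close>, and the gluing lemmas apply.
  They are applied to \<open>v\<close>, then to \<open>z\<close>, and then to the height \<open>\<theta>\<close>, whose derivative involves \<open>z\<close>
  and \<open>v\<close>.
\<close>

lemma horizontal_whitney_extension:
  fixes K :: "real set" and p h :: "real \<Rightarrow> (real ^ 'n::finite) \<times> (real ^ 'n)" and \<tau> :: "real \<Rightarrow> real"
  assumes K: "compact K" "K \<subseteq> {0..1}" "0 \<in> K" "1 \<in> K"
    and h: "continuous_on K h"
    and dp: "\<And>k. k \<in> K \<Longrightarrow> (p has_vector_derivative h k) (at k within K)"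
    and d\<tau>: "\<And>k. k \<in> K \<Longrightarrow> (\<tau> has_vector_derivative 2 * symp (p k) (h k)) (at k within K)"
    and unif: "\<And>\<eta>. \<eta> > 0 \<Longrightarrow> \<exists>r>0. \<forall>a\<in>K. \<forall>b\<in>K. a < b \<longrightarrow> b - a < r \<longrightarrow>
        norm (p b - p a - (b - a) *\<^sub>R h a) \<le> \<eta> * (b - a) \<and>
        \<bar>\<tau> b - \<tau> a - 2 * symp (p a) (p b)\<bar> \<le> \<eta> * (b - a)\<^sup>2"
  obtains z \<theta> v where "continuous_on {0..1} v"
    "\<And>t. t \<in> {0..1} \<Longrightarrow> (z has_vector_derivative v t) (at t within {0..1})"
    "\<And>t. t \<in> {0..1} \<Longrightarrow> (\<theta> has_vector_derivative 2 * symp (z t) (v t)) (at t within {0..1})"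
    "\<And>k. k \<in> K \<Longrightarrow> z k = p k \<and> \<theta> k = \<tau> k \<and> v k = h k"
proof -
  define m where "m a b = (1 / (b - a)) *\<^sub>R (p b - p a)" for a b
  define \<alpha> where "\<alpha> a b = (\<tau> b - \<tau> a - 2 * symp (p a) (p b)) / (b - a)\<^sup>2" for a b
  define Q where "Q a b u U \<Theta> \<longleftrightarrow> continuous_on {0..1} u \<and>
    (\<forall>\<sigma>\<in>{0..1}. (U has_vector_derivative u \<sigma>) (at \<sigma> within {0..1}) \<and>
       (\<Theta> has_vector_derivative 2 * symp (U \<sigma>) (u \<sigma>)) (at \<sigma> within {0..1}) \<and>
       norm (u \<sigma> - h a) \<le> interp_bound (norm (h a)) (norm (h b - h a) + norm (m a b - h a)) \<bar>\<alpha> a b\<bar>) \<and>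
    u 0 = h a \<and> u 1 = h b \<and> U 0 = 0 \<and> U 1 = m a b \<and> \<Theta> 0 = (0::real) \<and> \<Theta> 1 = \<alpha> a b" for a b u U \<Theta>
  have "\<exists>u U \<Theta>. Q a b u U \<Theta>" for a b
    unfolding Q_def by (rule horizontal_unit_interpolant)
  then obtain u U \<Theta> where Q: "\<And>a b. Q a b (u a b) (U a b) (\<Theta> a b)"
    by metis
  have cu: "continuous_on {0..1} (u a b)" for a b
    using Q[of a b] unfolding Q_def by blast
  have dU: "(U a b has_vector_derivative u a b \<sigma>) (at \<sigma> within {0..1})" if "\<sigma> \<in> {0..1}" for a b \<sigma>
    using Q[of a b] that unfolding Q_def by blast
  have d\<Theta>: "(\<Theta> a b has_vector_derivative 2 * symp (U a b \<sigma>) (u a b \<sigma>)) (at \<sigma> within {0..1})"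
    if "\<sigma> \<in> {0..1}" for a b \<sigma>
    using Q[of a b] that unfolding Q_def by blast
  have nu: "norm (u a b \<sigma> - h a) \<le> interp_bound (norm (h a)) (norm (h b - h a) + norm (m a b - h a)) \<bar>\<alpha> a b\<bar>"
    if "\<sigma> \<in> {0..1}" for a b \<sigma>
    using Q[of a b] that unfolding Q_def by blast
  have ends: "u a b 0 = h a" "u a b 1 = h b" "U a b 0 = 0" "U a b 1 = m a b"
      "\<Theta> a b 0 = 0" "\<Theta> a b 1 = \<alpha> a b" for a b
    using Q[of a b] unfolding Q_def by blast+
  define lo where "lo t = Sup (K \<inter> {..t})" for t
  define hi where "hi t = Inf (K \<inter> {t..})" for t
  define vg where "vg a b t = u a b ((t - a) / (b - a))" for a b t
  define zg where "zg a b t = p a + (b - a) *\<^sub>R U a b ((t - a) / (b - a))" for a b t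
  define \<theta>g where "\<theta>g a b t = \<tau> a + 2 * symp (p a) (zg a b t) + (b - a)\<^sup>2 * \<Theta> a b ((t - a) / (b - a))" for a b t
  define v where "v t = (if t \<in> K then h t else vg (lo t) (hi t) t)" for t
  define z where "z t = (if t \<in> K then p t else zg (lo t) (hi t) t)" for t
  define \<theta> where "\<theta> t = (if t \<in> K then \<tau> t else \<theta>g (lo t) (hi t) t)" for t
  \<comment> \<open>The formulas agree at both ends of a closed gap with the data on \<open>K\<close>.\<close>
  have on_gap: "v t = vg a b t \<and> z t = zg a b t \<and> \<theta> t = \<theta>g a b t"
    if ab: "a \<in> K" "b \<in> K" "a < b" "K \<inter> {a<..<b} = {}" and t: "t \<in> {a..b}" for a b t
  proof -
    consider "t = a" | "t = b" | "a < t" "t < b" using t by fastforce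
    then show ?thesis
    proof cases
      case 1
      then show ?thesis using ab
        by (simp add: v_def z_def \<theta>_def vg_def zg_def \<theta>g_def ends)
    next
      case 2
      have "zg a b b = p b" using ab by (simp add: zg_def ends m_def)
      then show ?thesis using 2 ab
        by (simp add: v_def z_def \<theta>_def vg_def \<theta>g_def ends \<alpha>_def)
    next
      case 3
      then have "t \<notin> K" "lo t = a" "hi t = b"
        using ab gap_endpoints_unique[OF ab(1,2,4) 3] by (auto simp: lo_def hi_def)
      then show ?thesis by (simp add: v_def z_def \<theta>_def)
    qed
  qed
  have unit: "(t - a) / (b - a) \<in> {0..1}" if "a < b" "t \<in> {a..b}" for a b t :: real
    using that by (auto simp: field_simps)
  have rescale: "((\<lambda>t. F ((t - a) / (b - a))) has_vector_derivative (1 / (b - a)) *\<^sub>R f ((t - a) / (b - a))) (at t within {a..b})"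
    if F: "\<And>\<sigma>. \<sigma> \<in> {0..1} \<Longrightarrow> (F has_vector_derivative f \<sigma>) (at \<sigma> within {0..1})" and ab: "a < b" and t: "t \<in> {a..b}"
    for F f :: "real \<Rightarrow> 'c::real_normed_vector" and a b t :: real
  proof -
    have 1: "((\<lambda>t. (t - a) / (b - a)) has_vector_derivative 1 / (b - a)) (at t within {a..b})"
      unfolding has_real_derivative_iff_has_vector_derivative[symmetric]
      using ab by (auto intro!: derivative_eq_intros)
    have "(F has_vector_derivative f ((t - a) / (b - a))) (at ((t - a) / (b - a)) within (\<lambda>t. (t - a) / (b - a)) ` {a..b})"
      using F[OF unit[OF ab t]] by (rule has_vector_derivative_within_subset) (use unit[OF ab] in auto)
    from vector_diff_chain_within[OF 1 this] show ?thesis by (simp add: o_def)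
  qed
  have dzg: "(zg a b has_vector_derivative vg a b t) (at t within {a..b})" if ab: "a < b" "t \<in> {a..b}" for a b t
  proof -
    have "((\<lambda>t. p a + (b - a) *\<^sub>R U a b ((t - a) / (b - a))) has_vector_derivative
        0 + (b - a) *\<^sub>R ((1 / (b - a)) *\<^sub>R u a b ((t - a) / (b - a)))) (at t within {a..b})"
      by (intro has_vector_derivative_add has_vector_derivative_const
          bounded_linear.has_vector_derivative[OF bounded_linear_scaleR_right] rescale dU ab)
    then show ?thesis using ab by (simp add: zg_def[abs_def] vg_def)
  qed
  have d\<theta>g: "(\<theta>g a b has_vector_derivative 2 * symp (zg a b t) (vg a b t)) (at t within {a..b})" if ab: "a < b" "t \<in> {a..b}" for a b t
  proof -
    let ?s = "(t - a) / (b - a)"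
    have "(\<theta>g a b has_vector_derivative 0 + 2 * symp (p a) (vg a b t)
        + (b - a)\<^sup>2 * ((1 / (b - a)) *\<^sub>R (2 * symp (U a b ?s) (u a b ?s)))) (at t within {a..b})"
      unfolding \<theta>g_def[abs_def]
      by (intro has_vector_derivative_add has_vector_derivative_const
          bounded_linear.has_vector_derivative[OF bounded_linear_mult_right]
          bounded_linear.has_vector_derivative[OF symp.bounded_linear_right] rescale d\<Theta> dzg ab)
    moreover have "0 + 2 * symp (p a) (vg a b t) + (b - a)\<^sup>2 * ((1 / (b - a)) *\<^sub>R (2 * symp (U a b ?s) (u a b ?s)))
        = 2 * symp (zg a b t) (vg a b t)"
      using ab by (simp add: zg_def vg_def symp.add_left symp.scaleR_left power2_eq_square)
    ultimately show ?thesis by simp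
  qed
  have cvg: "continuous_on {a..b} (vg a b)" if "a < b" for a b
    unfolding vg_def[abs_def] using unit[OF that] that
    by (intro continuous_on_compose2[OF cu] continuous_intros) auto
  have v: "continuous_on {0..1} v"
  proof (rule continuous_on_glue[OF K])
    show "continuous_on K v" using h by (rule continuous_on_eq) (simp add: v_def)
    show "continuous_on {a..b} v" if ab: "a \<in> K" "b \<in> K" "a < b" "K \<inter> {a<..<b} = {}" for a b
      using cvg[OF ab(3)] by (rule continuous_on_eq) (use on_gap[OF ab] in auto)
    fix \<eta> :: real assume \<eta>: "\<eta> > 0"
    obtain M where M: "\<And>k. k \<in> K \<Longrightarrow> norm (h k) \<le> M"
      using compact_imp_bounded[OF compact_continuous_image[OF h K(1)]] by (auto simp: bounded_iff)
    obtain \<delta> where \<delta>: "\<delta> > 0"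
        "\<And>H \<rho> \<alpha>. 0 \<le> H \<Longrightarrow> H \<le> M \<Longrightarrow> 0 \<le> \<rho> \<Longrightarrow> \<rho> \<le> \<delta> \<Longrightarrow> \<alpha> \<le> \<delta> \<Longrightarrow> interp_bound H \<rho> \<alpha> \<le> \<eta>"
      using interp_bound_small[OF \<eta>, of M] by blast
    have \<delta>2: "\<delta> / 2 > 0" using \<delta> by simp
    obtain r1 where r1: "r1 > 0" "\<And>a b. a \<in> K \<Longrightarrow> b \<in> K \<Longrightarrow> a < b \<Longrightarrow> b - a < r1 \<Longrightarrow>
        norm (p b - p a - (b - a) *\<^sub>R h a) \<le> \<delta> / 2 * (b - a) \<and>
        \<bar>\<tau> b - \<tau> a - 2 * symp (p a) (p b)\<bar> \<le> \<delta> / 2 * (b - a)\<^sup>2"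
      using unif[OF \<delta>2] by blast
    have "uniformly_continuous_on K h" using h K(1) by (rule compact_uniformly_continuous)
    then obtain r2 where r2: "r2 > 0" "\<And>a b. a \<in> K \<Longrightarrow> b \<in> K \<Longrightarrow> dist b a < r2 \<Longrightarrow> dist (h b) (h a) < \<delta> / 2"
      using \<delta>2 unfolding uniformly_continuous_on_def by blast
    have "norm (v t - v a) \<le> \<eta>"
      if ab: "a \<in> K" "b \<in> K" "K \<inter> {a<..<b} = {}" and t: "a < t" "t < b" and len: "b - a < min r1 r2" for a b t
    proof -
      have lt: "a < b" using t by simp
      have "norm (m a b - h a) \<le> \<delta> / 2"
      proof -
        have "m a b - h a = (1 / (b - a)) *\<^sub>R (p b - p a - (b - a) *\<^sub>R h a)"
          using lt by (simp add: m_def scaleR_diff_right)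
        then have "norm (m a b - h a) = norm (p b - p a - (b - a) *\<^sub>R h a) / (b - a)"
          using lt by simp
        then show ?thesis using r1(2)[OF ab(1,2) lt] len lt by (simp add: pos_divide_le_eq)
      qed
      moreover have "norm (h b - h a) \<le> \<delta> / 2"
        using r2(2)[OF ab(1,2)] len lt by (simp add: dist_norm)
      moreover have "\<bar>\<alpha> a b\<bar> \<le> \<delta> / 2"
        using r1(2)[OF ab(1,2) lt] len lt unfolding \<alpha>_def abs_divide by (simp add: pos_divide_le_eq)
      ultimately have "interp_bound (norm (h a)) (norm (h b - h a) + norm (m a b - h a)) \<bar>\<alpha> a b\<bar> \<le> \<eta>"
        using M[OF ab(1)] \<delta>(1) by (intro \<delta>(2)) auto
      moreover have "v t = u a b ((t - a) / (b - a))" "v a = h a"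
        using on_gap[OF ab(1,2) lt ab(3), of t] t ab by (auto simp: vg_def v_def)
      ultimately show ?thesis using nu[OF unit[OF lt, of t], of a b] t by auto
    qed
    then show "\<exists>r>0. \<forall>a\<in>K. \<forall>b\<in>K. \<forall>t. K \<inter> {a<..<b} = {} \<longrightarrow> a < t \<longrightarrow> t < b \<longrightarrow> b - a < r \<longrightarrow> norm (v t - v a) \<le> \<eta>"
      using r1(1) r2(1) by (intro exI[of _ "min r1 r2"]) auto
  qed
  have transfer: "(G has_vector_derivative D) (at t within S)"
    if "(F has_vector_derivative D) (at t within S)" "\<And>s. s \<in> S \<Longrightarrow> G s = F s" "t \<in> S"
    for F G :: "real \<Rightarrow> 'c::real_normed_vector" and D t S
    using that by (auto intro: has_vector_derivative_transform)
  have z: "(z has_vector_derivative v t) (at t within {0..1})" if "t \<in> {0..1}" for t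
  proof (rule has_vector_derivative_glue[OF K v _ _ that])
    show "(z has_vector_derivative v t) (at t within {a..b})"
      if "a \<in> K" "b \<in> K" "a < b" "K \<inter> {a<..<b} = {}" "t \<in> {a..b}" for a b t
      using transfer[OF dzg[OF that(3,5)], of z] on_gap[OF that(1-4)] that(5) by auto
    show "(z has_vector_derivative v k) (at k within K)" if "k \<in> K" for k
      using transfer[OF dp[OF that], of z] that by (auto simp: z_def v_def)
  qed
  have cz: "continuous_on {0..1} z"
    by (rule continuous_on_vector_derivative[OF z])
  have \<theta>: "(\<theta> has_vector_derivative 2 * symp (z t) (v t)) (at t within {0..1})" if "t \<in> {0..1}" for t
  proof (rule has_vector_derivative_glue[OF K _ _ _ that])
    show "continuous_on {0..1} (\<lambda>t. 2 * symp (z t) (v t))"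
      using cz v by (intro continuous_intros)
    show "(\<theta> has_vector_derivative 2 * symp (z t) (v t)) (at t within {a..b})"
      if "a \<in> K" "b \<in> K" "a < b" "K \<inter> {a<..<b} = {}" "t \<in> {a..b}" for a b t
      using transfer[OF d\<theta>g[OF that(3,5)], of \<theta>] on_gap[OF that(1-4)] that(5) by auto
    show "(\<theta> has_vector_derivative 2 * symp (z k) (v k)) (at k within K)" if "k \<in> K" for k
      using transfer[OF d\<tau>[OF that], of \<theta>] that by (auto simp: z_def v_def \<theta>_def)
  qed
  have "z k = p k \<and> \<theta> k = \<tau> k \<and> v k = h k" if "k \<in> K" for k
    using that by (simp add: v_def z_def \<theta>_def)
  then show ?thesis by (intro that[OF v z \<theta>]) auto
qed

section \<open>Horizontal curves and their Taylor estimates\<close>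

definition hproj :: "'n heis \<Rightarrow> (real ^ 'n::finite) \<times> (real ^ 'n)" where
  "hproj p = (fst p, fst (snd p))"

lemma bounded_linear_hproj: "bounded_linear (hproj :: 'n::finite heis \<Rightarrow> _)"
  unfolding hproj_def[abs_def]
  by (intro bounded_linear_Pair bounded_linear_fst bounded_linear_compose[OF bounded_linear_fst bounded_linear_snd])

lemma bounded_linear_vertical: "bounded_linear (\<lambda>p :: 'n::finite heis. snd (snd p))"
  by (rule bounded_linear_compose[OF bounded_linear_snd bounded_linear_snd])

lemma norm_hproj_le: "norm (hproj p) \<le> norm p"
proof -
  obtain x y t where p: "p = (x, y, t)" by (cases p)
  show ?thesis by (simp add: p hproj_def norm_prod_def)
qed

text \<open>
  A horizontal vector is determined by its horizontal part: the coefficients of the fields are the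
  coordinates of that part, and they fix the height.
\<close>

lemma horizontal_span_iff:
  fixes p v :: "'n::finite heis"
  shows "v \<in> span (range (\<lambda>i. heis_X i p) \<union> range (\<lambda>i. heis_Y i p)) \<longleftrightarrow>
    snd (snd v) = 2 * symp (hproj p) (hproj v)" (is "v \<in> span ?B \<longleftrightarrow> _")
proof
  obtain x y t where p: "p = (x, y, t)" by (cases p)
  show "snd (snd v) = 2 * symp (hproj p) (hproj v)" if "v \<in> span ?B"
    using that
  proof (induction rule: span_induct_alt)
    case base
    then show ?case by (simp add: hproj_def symp_def)
  next
    case (step c b w)
    have "snd (snd b) = 2 * symp (hproj p) (hproj b)"
      using step(1) by (auto simp: p hproj_def symp_def inner_axis)
    moreover have "hproj (c *\<^sub>R b + w) = c *\<^sub>R hproj b + hproj w"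
      by (simp add: hproj_def)
    ultimately show ?case using step(2)
      by (simp add: symp.add_right symp.scaleR_right algebra_simps)
  qed
  show "v \<in> span ?B" if v: "snd (snd v) = 2 * symp (hproj p) (hproj v)"
  proof -
    obtain a b s where ab: "v = (a, b, s)" by (cases v)
    have s: "s = (\<Sum>i\<in>UNIV. a $ i * (2 * y $ i)) + (\<Sum>i\<in>UNIV. b $ i * (- 2 * x $ i))"
      using v by (simp add: ab p hproj_def symp_def inner_vec_def sum_distrib_left sum_negf algebra_simps sum_subtractf)
    have "v = (\<Sum>i\<in>UNIV. a $ i *\<^sub>R heis_X i p) + (\<Sum>i\<in>UNIV. b $ i *\<^sub>R heis_Y i p)"
      using basis_expansion[of a] basis_expansion[of b]
      by (simp add: ab s p prod_eq_iff fst_sum snd_sum scalar_mult_eq_scaleR)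
    also have "\<dots> \<in> span ?B"
      by (intro span_add span_sum span_scale span_base) auto
    finally show ?thesis .
  qed
qed

lemma interval_lebesgue_integral_eq_integral:
  fixes g :: "real \<Rightarrow> 'a::euclidean_space"
  assumes "g absolutely_integrable_on {a..b}" "a \<le> t1" "t1 \<le> t2" "t2 \<le> b"
  shows "(LINT t=t1..t2|lebesgue. g t) = integral {t1..t2} g"
proof -
  have "set_integrable lebesgue {t1<..<t2} g"
    using assms by (intro set_integrable_subset[OF assms(1)]) auto
  then have "(LINT t:{t1<..<t2}|lebesgue. g t) = integral {t1<..<t2} g"
    by (rule set_lebesgue_integral_eq_integral)
  then show ?thesis
    using assms by (simp add: interval_lebesgue_integral_def integral_open_interval_real)
qed

lemma C1_imp_absolutely_continuous:
  fixes \<Gamma> :: "real \<Rightarrow> 'a::euclidean_space"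
  assumes "a < b" and D: "continuous_on {a..b} D"
    and \<Gamma>: "\<And>t. t \<in> {a..b} \<Longrightarrow> (\<Gamma> has_vector_derivative D t) (at t within {a..b})"
  shows "absolutely_continuous_curve a b \<Gamma>"
proof -
  let ?g = "\<lambda>t. vector_derivative \<Gamma> (at t within {a..b})"
  have g: "?g t = D t" if "t \<in> {a..b}" for t
    using vector_derivative_within_closed_interval[OF assms(1) that \<Gamma>[OF that]] .
  have ai: "?g absolutely_integrable_on {a..b}"
    using absolutely_integrable_continuous_real[OF D] g
    by (subst set_integrable_cong[OF refl refl, of _ _ D]) auto
  have le: "\<Gamma> t2 = \<Gamma> t1 + (LINT t=t1..t2|lebesgue. ?g t)" if "a \<le> t1" "t1 \<le> t2" "t2 \<le> b" for t1 t2
  proof -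
    have "(D has_integral (\<Gamma> t2 - \<Gamma> t1)) {t1..t2}"
      using that by (intro fundamental_theorem_of_calculus has_vector_derivative_within_subset[OF \<Gamma>]) auto
    then have "(?g has_integral (\<Gamma> t2 - \<Gamma> t1)) {t1..t2}"
      using that g by (subst has_integral_cong[of _ _ D]) auto
    then show ?thesis
      using interval_lebesgue_integral_eq_integral[OF ai that] by (simp add: integral_unique)
  qed
  have "\<Gamma> t2 = \<Gamma> t1 + (LINT t=t1..t2|lebesgue. ?g t)" if "t1 \<in> {a..b}" "t2 \<in> {a..b}" for t1 t2
  proof (cases "t1 \<le> t2")
    case False
    then have "(LINT t=t1..t2|lebesgue. ?g t) = - (LINT t=t2..t1|lebesgue. ?g t)"
      by (intro interval_lebesgue_integral_gt_eq') auto
    moreover have "\<Gamma> t1 = \<Gamma> t2 + (LINT t=t2..t1|lebesgue. ?g t)"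
      using False that by (intro le) auto
    ultimately show ?thesis by (metis add.right_neutral add.assoc add.right_inverse)
  next
    case True
    then show ?thesis using that by (intro le) auto
  qed
  moreover have "\<Gamma> differentiable (at t within {a..b})" if "t \<in> {a..b}" for t
    using \<Gamma>[OF that] by (rule differentiableI_vector)
  ultimately show ?thesis
    unfolding absolutely_continuous_curve_def using ai by (intro conjI ballI AE_I2 impI)
qed

text \<open>
  The second claim is about the height of \<open>\<gamma>(a)\<^sup>-\<^sup>1 \<gamma>(b)\<close>. By horizontality it is the integral over \<open>s\<close> of
  \<open>2 * symp (hproj (\<gamma> s) - hproj (\<gamma> a)) (hproj (g s))\<close>. Both arguments are multiples of \<open>h = hproj (g a)\<close> up
  to errors; the main term vanishes because \<open>symp h h = 0\<close>, and the errors are small in mean.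
\<close>

lemma horizontal_curve_taylor:
  fixes \<gamma> g :: "real \<Rightarrow> 'n::finite heis"
  assumes ab: "a < b"
    and g: "g absolutely_integrable_on {a..b}"
    and \<gamma>: "\<And>s. s \<in> {a..b} \<Longrightarrow> \<gamma> s = \<gamma> a + integral {a..s} g"
    and hor: "\<And>s. s \<in> {a..b} \<Longrightarrow> snd (snd (g s)) = 2 * symp (hproj (\<gamma> s)) (hproj (g s))"
    and \<eta>: "0 \<le> \<eta>" and leb: "\<And>s. a < s \<Longrightarrow> s \<le> b \<Longrightarrow>
      (\<integral>\<^sup>+x\<in>{a..s}. ennreal (norm (g x - g a)) \<partial>lebesgue) \<le> ennreal (\<eta> * (s - a))"
    and M: "norm (g a) \<le> M"
  shows "norm (hproj (\<gamma> b) - hproj (\<gamma> a) - (b - a) *\<^sub>R hproj (g a)) \<le> \<eta> * (b - a)"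
    and "\<bar>snd (snd (\<gamma> b)) - snd (snd (\<gamma> a)) - 2 * symp (hproj (\<gamma> a)) (hproj (\<gamma> b))\<bar>
      \<le> 2 * (2 * M * \<eta> + \<eta>\<^sup>2) * (b - a)\<^sup>2"
proof -
  interpret P: bounded_linear "hproj :: 'n heis \<Rightarrow> _" by (rule bounded_linear_hproj)
  have ai: "g absolutely_integrable_on {a..s}" if "s \<le> b" for s
    using that by (intro absolutely_integrable_on_subinterval[OF g]) auto
  have ai': "(\<lambda>x. g x - g a) absolutely_integrable_on {a..s}" if "s \<le> b" for s
    by (rule set_integral_diff(1)[OF ai[OF that] absolutely_integrable_continuous_real[OF continuous_on_const]])
  have E: "(\<lambda>x. norm (g x - g a)) integrable_on {a..s}" if "s \<le> b" for s
    using ai'[OF that] by (simp add: absolutely_integrable_on_def)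
  have int_le: "integral {a..s} (\<lambda>x. norm (g x - g a)) \<le> \<eta> * (s - a)" if s: "a < s" "s \<le> b" for s
  proof -
    let ?I = "integral {a..s} (\<lambda>x. norm (g x - g a))"
    have "ennreal ?I = (\<integral>\<^sup>+x\<in>{a..s}. ennreal (norm (g x - g a)) \<partial>lebesgue)"
      unfolding nn_integral_completion
      by (rule nn_integral_has_integral_lebesgue'[symmetric]) (use E[OF s(2)] in auto)
    also have "\<dots> \<le> ennreal (\<eta> * (s - a))" using leb s by simp
    finally show ?thesis using \<eta> s by (simp add: ennreal_le_iff)
  qed
  have first: "norm (hproj (\<gamma> s) - hproj (\<gamma> a) - (s - a) *\<^sub>R hproj (g a)) \<le> \<eta> * (s - a)"
    if s: "a \<le> s" "s \<le> b" for s
  proof (cases "a = s")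
    case False
    then have as: "a < s" using s by simp
    have "\<gamma> s - \<gamma> a - (s - a) *\<^sub>R g a = integral {a..s} (\<lambda>x. g x - g a)"
      using \<gamma>[of s] s ai[OF s(2)] by (subst integral_diff) (auto simp: absolutely_integrable_on_def)
    also have "norm \<dots> \<le> integral {a..s} (\<lambda>x. norm (g x - g a))"
      using ai'[OF s(2)] E[OF s(2)] by (intro integral_norm_bound_integral) (auto simp: absolutely_integrable_on_def)
    also have "\<dots> \<le> \<eta> * (s - a)" using int_le as s by simp
    finally have "norm (hproj (\<gamma> s - \<gamma> a - (s - a) *\<^sub>R g a)) \<le> \<eta> * (s - a)"
      by (rule order_trans[OF norm_hproj_le])
    then show ?thesis by (simp add: P.diff P.scaleR)
  qed simp
  then show "norm (hproj (\<gamma> b) - hproj (\<gamma> a) - (b - a) *\<^sub>R hproj (g a)) \<le> \<eta> * (b - a)"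
    using ab by simp
  define h where "h = hproj (g a)"
  have hM: "norm h \<le> M" using M norm_hproj_le[of "g a"] by (simp add: h_def)
  have M0: "0 \<le> M" by (rule order_trans[OF norm_ge_zero M])
  \<comment> \<open>\<open>L (\<gamma> b - \<gamma> a)\<close> is the height in question, and \<open>L\<close> is linear, so it may be moved under the integral.\<close>
  define L where "L w = snd (snd w) - 2 * symp (hproj (\<gamma> a)) (hproj w)" for w :: "'n heis"
  have L: "bounded_linear L"
    unfolding L_def[abs_def]
    by (intro bounded_linear_sub bounded_linear_vertical bounded_linear_const_mult
        bounded_linear_compose[OF symp.bounded_linear_right bounded_linear_hproj])
  have "(g has_integral (\<gamma> b - \<gamma> a)) {a..b}"
    using \<gamma>[of b] ab ai[of b] by (auto simp: absolutely_integrable_on_def has_integral_integral)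
  from has_integral_linear[OF this L]
  have I: "((\<lambda>s. L (g s)) has_integral L (\<gamma> b - \<gamma> a)) {a..b}" by (simp add: o_def)
  define B where "B s = 2 * (b - a) * ((M + \<eta>) * norm (g s - g a) + \<eta> * M)" for s
  have Lg: "norm (L (g s)) \<le> B s" if s: "s \<in> {a..b}" for s
  proof -
    define \<rho> where "\<rho> = hproj (\<gamma> s) - hproj (\<gamma> a) - (s - a) *\<^sub>R h"
    define e where "e = hproj (g s) - h"
    have "norm \<rho> \<le> \<eta> * (s - a)"
      using first[of s] s unfolding \<rho>_def h_def by simp
    also have "\<dots> \<le> \<eta> * (b - a)" using s \<eta> by (intro mult_left_mono) auto
    finally have \<rho>n: "norm \<rho> \<le> \<eta> * (b - a)" .
    have en: "norm e \<le> norm (g s - g a)"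
      using norm_hproj_le[of "g s - g a"] by (simp add: e_def h_def P.diff)
    have "L (g s) = 2 * symp (hproj (\<gamma> s) - hproj (\<gamma> a)) (hproj (g s))"
      using hor[OF s] by (simp add: L_def symp.diff_left)
    also have "hproj (\<gamma> s) - hproj (\<gamma> a) = (s - a) *\<^sub>R h + \<rho>" by (simp add: \<rho>_def)
    also have "hproj (g s) = h + e" by (simp add: e_def)
    also have "symp ((s - a) *\<^sub>R h + \<rho>) (h + e) = (s - a) * symp h e + symp \<rho> h + symp \<rho> e"
      by (simp add: symp.add_left symp.add_right symp.scaleR_left)
    finally have eq: "L (g s) = 2 * ((s - a) * symp h e + symp \<rho> h + symp \<rho> e)" .
    have "\<bar>(s - a) * symp h e\<bar> \<le> (b - a) * (M * norm (g s - g a))"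
      unfolding abs_mult using s hM en M0
      by (intro mult_mono order_trans[OF abs_symp_le]) auto
    moreover have "\<bar>symp \<rho> h\<bar> \<le> (\<eta> * (b - a)) * M"
      using \<rho>n hM ab \<eta> by (intro order_trans[OF abs_symp_le] mult_mono) auto
    moreover have "\<bar>symp \<rho> e\<bar> \<le> (\<eta> * (b - a)) * norm (g s - g a)"
      using \<rho>n en ab \<eta> by (intro order_trans[OF abs_symp_le] mult_mono) auto
    ultimately have "\<bar>(s - a) * symp h e + symp \<rho> h + symp \<rho> e\<bar>
        \<le> (b - a) * (M * norm (g s - g a)) + (\<eta> * (b - a)) * M + (\<eta> * (b - a)) * norm (g s - g a)"
      by linarith
    then show ?thesis unfolding eq B_def real_norm_def abs_mult by (simp add: algebra_simps)
  qed
  have IB: "(B has_integral (2 * (b - a) * ((M + \<eta>) * integral {a..b} (\<lambda>x. norm (g x - g a)) + (b - a) * (\<eta> * M)))) {a..b}"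
    unfolding B_def using ab E[of b] has_integral_const_real[of "\<eta> * M" a b]
    by (intro has_integral_mult_right has_integral_add integrable_integral) auto
  have "norm (L (\<gamma> b - \<gamma> a)) = norm (integral {a..b} (\<lambda>s. L (g s)))"
    using I by (simp add: integral_unique)
  also have "\<dots> \<le> integral {a..b} B"
    using I IB Lg by (intro integral_norm_bound_integral) (auto simp: integrable_on_def)
  also have "\<dots> = 2 * (b - a) * ((M + \<eta>) * integral {a..b} (\<lambda>x. norm (g x - g a)) + (b - a) * (\<eta> * M))"
    using IB by (rule integral_unique)
  also have "\<dots> \<le> 2 * (b - a) * ((M + \<eta>) * (\<eta> * (b - a)) + (b - a) * (\<eta> * M))"
    using int_le[of b] ab M0 \<eta> by (intro mult_left_mono add_right_mono) auto
  also have "\<dots> = 2 * (2 * M * \<eta> + \<eta>\<^sup>2) * (b - a)\<^sup>2"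
    by (simp add: power2_eq_square algebra_simps)
  finally show "\<bar>snd (snd (\<gamma> b)) - snd (snd (\<gamma> a)) - 2 * symp (hproj (\<gamma> a)) (hproj (\<gamma> b))\<bar>
      \<le> 2 * (2 * M * \<eta> + \<eta>\<^sup>2) * (b - a)\<^sup>2"
    by (simp add: L_def P.diff symp.diff_right)
qed

section \<open>Lusin approximation\<close>

text \<open>
  At an isolated point any derivative will do. This lets the ends 0 and 1 be added to the good set.
\<close>

lemma has_vector_derivative_isolated:
  assumes "\<not> x islimpt S"
  shows "(f has_vector_derivative D) (at x within S)"
  using assms trivial_limit_within[of x S]
  by (simp add: has_vector_derivative_def has_derivative_def bounded_linear_scaleR_left)

lemma continuous_imp_measurable_indicator:
  fixes F :: "real \<Rightarrow> 'a::euclidean_space"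
  assumes "continuous_on {a..b} F"
  shows "(\<lambda>t. indicator {a..b} t *\<^sub>R F t) \<in> borel_measurable lebesgue"
  using absolutely_integrable_continuous_real[OF assms]
  by (auto simp: set_integrable_def)

text \<open>
  The good set \<open>K0\<close> is a closed set of almost full measure on which \<open>\<gamma>\<close> has a horizontal derivative, the
  derivative is continuous, and the points are Lebesgue points of it with a uniform rate. The
  Taylor estimates show that \<open>\<gamma>\<close> restricted to \<open>K0\<close> satisfies the hypotheses of the extension theorem.
\<close>

theorem theorem2p2:
  fixes \<gamma> :: "real \<Rightarrow> 'n::finite heis" and \<epsilon> :: real
  assumes "horizontal_curve 0 1 \<gamma>"
    and "\<epsilon> > 0"
  shows "\<exists>\<Gamma> :: real \<Rightarrow> 'n heis.
           C1_curve 0 1 \<Gamma> \<and> horizontal_curve 0 1 \<Gamma> \<and>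
           (let B = {t \<in> {0..1}. \<Gamma> t \<noteq> \<gamma> t \<or>
                      \<not> (\<exists>v. (\<Gamma> has_vector_derivative v) (at t within {0..1}) \<and>
                             (\<gamma> has_vector_derivative v) (at t within {0..1}))}
            in B \<in> sets lebesgue \<and> emeasure lebesgue B < ennreal \<epsilon>)"
proof -
  let ?I = "{0..1} :: real set"
  define g0 where "g0 t = vector_derivative \<gamma> (at t within ?I)" for t
  have ac: "absolutely_continuous_curve 0 1 \<gamma>"
    and ae: "AE t in lebesgue. t \<in> ?I \<longrightarrow>
        (\<exists>v \<in> span (range (\<lambda>i. heis_X i (\<gamma> t)) \<union> range (\<lambda>i. heis_Y i (\<gamma> t))).
           (\<gamma> has_vector_derivative v) (at t within ?I))"
    using assms(1) by (auto simp: horizontal_curve_def)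
  have g0: "g0 absolutely_integrable_on ?I"
    using ac by (simp add: absolutely_continuous_curve_def g0_def[abs_def])
  obtain N where N: "negligible N" and diff: "\<And>t. t \<in> ?I - N \<Longrightarrow>
        (\<exists>v \<in> span (range (\<lambda>i. heis_X i (\<gamma> t)) \<union> range (\<lambda>i. heis_Y i (\<gamma> t))).
           (\<gamma> has_vector_derivative v) (at t within ?I))"
    using ae unfolding eventually_ae_filter_negligible by blast
  \<comment> \<open>Redefine the derivative as 0 on the exceptional null set and outside the interval; this keeps\<close>
  \<comment> \<open>the integral and makes horizontality hold at every point.\<close>
  define g where "g t = (if t \<in> ?I - N then g0 t else 0)" for t
  have dg: "(\<gamma> has_vector_derivative g t) (at t within ?I)"
    and hg: "snd (snd (g t)) = 2 * symp (hproj (\<gamma> t)) (hproj (g t))" if t: "t \<in> ?I - N" for t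
  proof -
    obtain v where v: "v \<in> span (range (\<lambda>i. heis_X i (\<gamma> t)) \<union> range (\<lambda>i. heis_Y i (\<gamma> t)))"
      "(\<gamma> has_vector_derivative v) (at t within ?I)" using diff[OF t] by blast
    have "g t = v"
      using vector_derivative_within_closed_interval[OF _ _ v(2)] t by (simp add: g_def g0_def)
    then show "(\<gamma> has_vector_derivative g t) (at t within ?I)"
        "snd (snd (g t)) = 2 * symp (hproj (\<gamma> t)) (hproj (g t))"
      using v by (simp_all add: horizontal_span_iff)
  qed
  have hg': "snd (snd (g t)) = 2 * symp (hproj (\<gamma> t)) (hproj (g t))" for t
    using hg[of t] by (cases "t \<in> ?I - N") (simp_all add: g_def hproj_def symp_def)
  have gI: "g absolutely_integrable_on ?I"
    by (rule absolutely_integrable_spike[OF g0 N]) (simp add: g_def)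
  have gi: "integrable lebesgue g"
  proof -
    have "(\<lambda>t. indicator ?I t *\<^sub>R g t) = g" by (auto simp: g_def indicator_def)
    then show ?thesis using gI by (simp add: set_integrable_def)
  qed
  have \<gamma>: "\<gamma> t = \<gamma> s + integral {s..t} g" if "0 \<le> s" "s \<le> t" "t \<le> 1" for s t
  proof -
    have "\<gamma> t = \<gamma> s + (LINT x=s..t|lebesgue. g0 x)"
    proof -
      have "\<forall>s\<in>?I. \<forall>t\<in>?I. \<gamma> t = \<gamma> s + (LINT x=s..t|lebesgue. g0 x)"
        using ac unfolding absolutely_continuous_curve_def g0_def by blast
      moreover have "s \<in> ?I" "t \<in> ?I" using that by auto
      ultimately show ?thesis by blast
    qed
    also have "(LINT x=s..t|lebesgue. g0 x) = integral {s..t} g0"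
      using interval_lebesgue_integral_eq_integral[OF g0 that] .
    also have "\<dots> = integral {s..t} g"
      by (rule integral_spike[OF N]) (use that in \<open>auto simp: g_def\<close>)
    finally show ?thesis .
  qed
  have c\<gamma>: "continuous_on ?I \<gamma>"
  proof -
    have "g integrable_on ?I" using gI by (simp add: absolutely_integrable_on_def)
    then have "continuous_on ?I (\<lambda>t. \<gamma> 0 + integral {0..t} g)"
      by (intro continuous_intros indefinite_integral_continuous_1)
    then show ?thesis by (rule continuous_on_eq) (rule \<gamma>[symmetric]; simp)
  qed
  have e2: "\<epsilon> / 2 > 0" using assms(2) by simp
  obtain T where T: "T \<in> sets lebesgue" "emeasure lebesgue T < ennreal (\<epsilon> / 2)"
    "continuous_on (?I - T) g"
    "\<And>\<eta>. \<eta> > 0 \<Longrightarrow> \<exists>r>0. \<forall>x a b. x \<notin> T \<longrightarrow> 0 \<le> a \<longrightarrow> a < b \<longrightarrow> b \<le> 1 \<longrightarrow> x \<in> {a..b} \<longrightarrow> b - a < r \<longrightarrow>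
       (\<integral>\<^sup>+s\<in>{a..b}. ennreal (norm (g s - g x)) \<partial>lebesgue) \<le> ennreal (\<eta> * (b - a))"
    by (rule uniform_lebesgue_points[OF gi e2, of 0 1]) blast
  define A where "A = ?I - N - T"
  have Am: "A \<in> sets lebesgue" unfolding A_def using T(1) negligible_imp_sets[OF N] by (intro sets.Diff) auto
  obtain K0 where K0: "closed K0" "K0 \<subseteq> A" "emeasure lebesgue (A - K0) < ennreal (\<epsilon> / 2)"
    using sets_lebesgue_inner_closed[OF Am e2] by metis
  have K0I: "K0 \<subseteq> ?I - N" "K0 \<subseteq> ?I - T" "K0 \<subseteq> ?I" using K0(2) by (auto simp: A_def)
  have cK0: "compact K0"
    using K0(1) K0I(3) by (meson bounded_closed_interval bounded_subset compact_eq_bounded_closed)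
  \<comment> \<open>Adding 0 and 1 makes every complementary interval a gap with two ends in \<open>K\<close>. Where one of them\<close>
  \<comment> \<open>is not in \<open>K0\<close>, it is isolated, and any horizontal velocity may be prescribed; \<open>h\<close> takes 0.\<close>
  define K where "K = K0 \<union> {0, 1}"
  define h where "h t = (if t \<in> K0 then hproj (g t) else 0)" for t
  have K: "compact K" "K \<subseteq> ?I" "0 \<in> K" "1 \<in> K"
    using cK0 K0I(3) by (auto simp: K_def)
  have isolated: "\<not> k islimpt K" if "k \<notin> K0" for k
    using that K0(1) unfolding K_def islimpt_Un closed_limpt by (auto simp: islimpt_finite)
  have cg: "continuous_on K0 g" using T(3) K0I(2) by (rule continuous_on_subset)
  have ch: "continuous_on K h"
  proof -
    have "continuous_on K0 (\<lambda>t. hproj (g t))"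
      using cg by (intro bounded_linear.continuous_on[OF bounded_linear_hproj])
    then have "continuous_on K0 h" by (rule continuous_on_eq) (simp add: h_def)
    moreover have "continuous_on ({0, 1} - K0) h"
      by (intro continuous_on_finite) auto
    moreover have "closed ({0, 1} - K0)" by (intro finite_imp_closed) auto
    ultimately have "continuous_on (K0 \<union> ({0, 1} - K0)) h"
      using K0(1) by (intro continuous_on_closed_Un)
    then show ?thesis by (simp add: K_def)
  qed
  define p where "p t = hproj (\<gamma> t)" for t
  define \<tau> where "\<tau> t = snd (snd (\<gamma> t))" for t
  have dK: "(\<gamma> has_vector_derivative g k) (at k within K)" if "k \<in> K0" for k
    by (rule has_vector_derivative_within_subset[OF dg K(2)]) (use that K0I in blast)
  have dp: "(p has_vector_derivative h k) (at k within K)" if "k \<in> K" for k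
  proof (cases "k \<in> K0")
    case True
    then show ?thesis
      using bounded_linear.has_vector_derivative[OF bounded_linear_hproj dK[OF True]]
      by (simp add: p_def[abs_def] h_def)
  qed (intro has_vector_derivative_isolated isolated)
  have d\<tau>: "(\<tau> has_vector_derivative 2 * symp (p k) (h k)) (at k within K)" if "k \<in> K" for k
  proof (cases "k \<in> K0")
    case True
    then show ?thesis
      using bounded_linear.has_vector_derivative[OF bounded_linear_vertical dK[OF True]]
      by (simp add: \<tau>_def[abs_def] p_def h_def hg')
  qed (intro has_vector_derivative_isolated isolated)
  obtain M where M: "M > 0" "\<And>k. k \<in> K0 \<Longrightarrow> norm (g k) \<le> M"
    using compact_imp_bounded[OF compact_continuous_image[OF cg cK0]] by (auto simp: bounded_pos)
  \<comment> \<open>No point of \<open>K\<close> other than 0 and 1 is closer than \<open>r0\<close> to an added 0, so pairs starting at 0 impose no smallness.\<close>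
  obtain r0 where r0: "r0 > 0" "0 \<notin> K0 \<Longrightarrow> {0..<r0} \<inter> K0 = {}"
  proof (cases "0 \<in> K0")
    case False
    then obtain e where e: "e > 0" "ball 0 e \<subseteq> - K0"
      using K0(1) by (meson ComplI open_Compl open_contains_ball)
    then show ?thesis by (intro that[of e]) (auto simp: subset_iff)
  qed (use that[of 1] in auto)
  have unif: "\<exists>r>0. \<forall>a\<in>K. \<forall>b\<in>K. a < b \<longrightarrow> b - a < r \<longrightarrow>
        norm (p b - p a - (b - a) *\<^sub>R h a) \<le> \<eta> * (b - a) \<and>
        \<bar>\<tau> b - \<tau> a - 2 * symp (p a) (p b)\<bar> \<le> \<eta> * (b - a)\<^sup>2" if \<eta>: "\<eta> > 0" for \<eta>
  proof -
    define \<delta> where "\<delta> = min 1 (\<eta> / (4 * M + 2))"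
    have \<delta>: "0 < \<delta>" "\<delta> \<le> 1" "(4 * M + 2) * \<delta> \<le> \<eta>"
    proof -
      have pos: "4 * M + 2 > 0" using M(1) by simp
      show "0 < \<delta>" "\<delta> \<le> 1" using \<eta> pos by (auto simp: \<delta>_def)
      have "(4 * M + 2) * \<delta> \<le> (4 * M + 2) * (\<eta> / (4 * M + 2))"
        using pos by (intro mult_left_mono) (auto simp: \<delta>_def)
      then show "(4 * M + 2) * \<delta> \<le> \<eta>" using pos by simp
    qed
    have "1 * \<delta> \<le> (4 * M + 2) * \<delta>" using \<delta> M(1) by (intro mult_right_mono) auto
    then have \<delta>\<eta>: "\<delta> \<le> \<eta>" using \<delta>(3) by linarith
    have "\<delta>\<^sup>2 \<le> \<delta>" using \<delta> by (simp add: power2_eq_square mult_left_le)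
    then have \<delta>2: "2 * (2 * M * \<delta> + \<delta>\<^sup>2) \<le> \<eta>" using \<delta>(3) by (simp add: algebra_simps)
    obtain r where r: "r > 0" "\<And>x a b. x \<notin> T \<Longrightarrow> 0 \<le> a \<Longrightarrow> a < b \<Longrightarrow> b \<le> 1 \<Longrightarrow> x \<in> {a..b} \<Longrightarrow> b - a < r \<Longrightarrow>
       (\<integral>\<^sup>+s\<in>{a..b}. ennreal (norm (g s - g x)) \<partial>lebesgue) \<le> ennreal (\<delta> * (b - a))"
      using T(4)[OF \<delta>(1)] by blast
    have "norm (p b - p a - (b - a) *\<^sub>R h a) \<le> \<eta> * (b - a) \<and>
        \<bar>\<tau> b - \<tau> a - 2 * symp (p a) (p b)\<bar> \<le> \<eta> * (b - a)\<^sup>2"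
      if ab: "a \<in> K" "b \<in> K" "a < b" and len: "b - a < min r (min r0 1)" for a b
    proof -
      have ab01: "0 \<le> a" "b \<le> 1" using ab K(2) by auto
      have aK0: "a \<in> K0"
      proof (rule ccontr)
        assume "a \<notin> K0"
        then have a0: "a = 0" "0 \<notin> K0" using ab ab01 by (auto simp: K_def)
        then have "b \<noteq> 0" "b \<noteq> 1" "b \<in> {0..<r0}" using ab len by auto
        then show False using r0(2)[OF a0(2)] ab(2) by (auto simp: K_def)
      qed
      then have aT: "a \<notin> T" using K0I by auto
      have gab: "g absolutely_integrable_on {a..b}"
        using ab01 by (intro absolutely_integrable_on_subinterval[OF gI]) auto
      note tay = horizontal_curve_taylor[OF ab(3) gab, of \<gamma> \<delta> M]
      have 1: "\<And>s. s \<in> {a..b} \<Longrightarrow> \<gamma> s = \<gamma> a + integral {a..s} g"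
        by (rule \<gamma>) (use ab01 in auto)
      have 2: "(\<integral>\<^sup>+x\<in>{a..s}. ennreal (norm (g x - g a)) \<partial>lebesgue) \<le> ennreal (\<delta> * (s - a))"
        if "a < s" "s \<le> b" for s
        by (rule r(2)[OF aT]) (use that ab01 len in auto)
      have t1: "norm (p b - p a - (b - a) *\<^sub>R h a) \<le> \<delta> * (b - a)"
        using tay(1)[OF 1 hg' _ 2 M(2)[OF aK0]] \<delta>(1) aK0 by (simp add: p_def h_def)
      have t2: "\<bar>\<tau> b - \<tau> a - 2 * symp (p a) (p b)\<bar> \<le> 2 * (2 * M * \<delta> + \<delta>\<^sup>2) * (b - a)\<^sup>2"
        using tay(2)[OF 1 hg' _ 2 M(2)[OF aK0]] \<delta>(1) by (simp add: p_def \<tau>_def)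
      have "\<delta> * (b - a) \<le> \<eta> * (b - a)" using \<delta>\<eta> ab(3) by (intro mult_right_mono) auto
      moreover have "2 * (2 * M * \<delta> + \<delta>\<^sup>2) * (b - a)\<^sup>2 \<le> \<eta> * (b - a)\<^sup>2"
        using \<delta>2 by (intro mult_right_mono) auto
      ultimately show ?thesis using t1 t2 by linarith
    qed
    then show ?thesis using r(1) r0(1) by (intro exI[of _ "min r (min r0 1)"]) auto
  qed
  obtain z \<theta> v where v: "continuous_on ?I v"
    and dz: "\<And>t. t \<in> ?I \<Longrightarrow> (z has_vector_derivative v t) (at t within ?I)"
    and d\<theta>: "\<And>t. t \<in> ?I \<Longrightarrow> (\<theta> has_vector_derivative 2 * symp (z t) (v t)) (at t within ?I)"
    and onK: "\<And>k. k \<in> K \<Longrightarrow> z k = p k \<and> \<theta> k = \<tau> k \<and> v k = h k"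
    by (rule horizontal_whitney_extension[OF K ch dp d\<tau> unif]) (assumption | rule that | blast)+
  define \<Gamma> :: "real \<Rightarrow> 'n heis" where "\<Gamma> t = (fst (z t), snd (z t), \<theta> t)" for t
  define D :: "real \<Rightarrow> 'n heis" where "D t = (fst (v t), snd (v t), 2 * symp (z t) (v t))" for t
  have d\<Gamma>: "(\<Gamma> has_vector_derivative D t) (at t within ?I)" if "t \<in> ?I" for t
    unfolding \<Gamma>_def[abs_def] D_def
    by (intro has_vector_derivative_Pair d\<theta> that
        bounded_linear.has_vector_derivative[OF bounded_linear_fst dz]
        bounded_linear.has_vector_derivative[OF bounded_linear_snd dz])
  have cD: "continuous_on ?I D"
    unfolding D_def using v continuous_on_vector_derivative[OF dz] by (intro continuous_intros) auto
  have D\<Gamma>: "D t \<in> span (range (\<lambda>i. heis_X i (\<Gamma> t)) \<union> range (\<lambda>i. heis_Y i (\<Gamma> t)))" for t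
    unfolding horizontal_span_iff by (simp add: D_def \<Gamma>_def hproj_def)
  have C1: "C1_curve 0 1 \<Gamma>" unfolding C1_curve_def using d\<Gamma> cD by blast
  have hor: "horizontal_curve 0 1 \<Gamma>"
    unfolding horizontal_curve_def
    using C1_imp_absolutely_continuous[OF _ cD d\<Gamma>] d\<Gamma> D\<Gamma> by (auto intro!: AE_I2)
  have agree: "\<Gamma> k = \<gamma> k \<and> D k = g k" if k: "k \<in> K0" for k
  proof -
    have "k \<in> K" using k by (simp add: K_def)
    then have "z k = hproj (\<gamma> k)" "\<theta> k = snd (snd (\<gamma> k))" "v k = hproj (g k)"
      using onK[of k] k by (simp_all add: p_def \<tau>_def h_def)
    then show ?thesis
      using hg'[of k] by (cases "\<gamma> k"; cases "g k") (simp add: \<Gamma>_def D_def hproj_def)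
  qed
  define B where "B = {t \<in> ?I. \<Gamma> t \<noteq> \<gamma> t \<or>
                      \<not> (\<exists>v. (\<Gamma> has_vector_derivative v) (at t within ?I) \<and>
                             (\<gamma> has_vector_derivative v) (at t within ?I))}"
  have B_iff: "t \<in> B \<longleftrightarrow> \<Gamma> t \<noteq> \<gamma> t \<or> D t \<noteq> g t" if t: "t \<in> ?I - N" for t
  proof -
    have tI: "t \<in> ?I" using t by simp
    have unique: "w = w'"
      if "(F has_vector_derivative w) (at t within ?I)" "(F has_vector_derivative w') (at t within ?I)"
      for F :: "real \<Rightarrow> 'n heis" and w w'
      using vector_derivative_within_closed_interval[OF zero_less_one tI that(1)]
        vector_derivative_within_closed_interval[OF zero_less_one tI that(2)] by simp
    have "(\<exists>v. (\<Gamma> has_vector_derivative v) (at t within ?I) \<and> (\<gamma> has_vector_derivative v) (at t within ?I))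
        \<longleftrightarrow> D t = g t"
    proof
      assume "\<exists>v. (\<Gamma> has_vector_derivative v) (at t within ?I) \<and> (\<gamma> has_vector_derivative v) (at t within ?I)"
      then obtain w where "(\<Gamma> has_vector_derivative w) (at t within ?I)" "(\<gamma> has_vector_derivative w) (at t within ?I)"
        by blast
      then show "D t = g t" using unique[OF d\<Gamma>[OF tI]] unique[OF dg[OF t]] by blast
    next
      assume "D t = g t"
      then show "\<exists>v. (\<Gamma> has_vector_derivative v) (at t within ?I) \<and> (\<gamma> has_vector_derivative v) (at t within ?I)"
        using d\<Gamma>[OF tI] dg[OF t] by metis
    qed
    then show ?thesis unfolding B_def using tI by blast
  qed
  have BK0: "B \<inter> K0 = {}"
    using B_iff K0I agree by blast
  have Bm: "B \<in> sets lebesgue"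
  proof -
    have c\<Gamma>: "continuous_on ?I \<Gamma>" by (rule continuous_on_vector_derivative[OF d\<Gamma>])
    have [measurable]: "(\<lambda>t. indicator ?I t *\<^sub>R (\<Gamma> t - \<gamma> t)) \<in> borel_measurable lebesgue"
      using c\<Gamma> c\<gamma> by (intro continuous_imp_measurable_indicator continuous_intros)
    have [measurable]: "(\<lambda>t. indicator ?I t *\<^sub>R D t) \<in> borel_measurable lebesgue"
      using cD by (intro continuous_imp_measurable_indicator)
    have [measurable]: "g \<in> borel_measurable lebesgue" using gi by auto
    \<comment> \<open>Up to a subset of the null set \<open>N\<close>, \<open>B\<close> is where the measurable functions \<open>\<Gamma> - \<gamma>\<close> or \<open>D - g\<close> do not vanish.\<close>
    define E where "E = {t \<in> space lebesgue. indicator ?I t *\<^sub>R (\<Gamma> t - \<gamma> t) \<noteq> 0 \<or> indicator ?I t *\<^sub>R D t - g t \<noteq> 0}"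
    have Em: "E \<in> sets lebesgue" unfolding E_def by measurable
    have "B = (E - N) \<union> (B \<inter> N)"
    proof (intro set_eqI)
      fix t
      show "t \<in> B \<longleftrightarrow> t \<in> (E - N) \<union> (B \<inter> N)"
      proof (cases "t \<in> ?I - N")
        case True
        then show ?thesis using B_iff[OF True] by (auto simp: E_def)
      next
        case False
        then show ?thesis by (auto simp: E_def B_def g_def)
      qed
    qed
    moreover have "B \<inter> N \<in> sets lebesgue"
      by (rule negligible_imp_sets[OF negligible_subset[OF N]]) auto
    ultimately show ?thesis using Em negligible_imp_sets[OF N] by (metis sets.Diff sets.Un)
  qed
  have "emeasure lebesgue B < ennreal \<epsilon>"
  proof -
    have Ns: "N \<in> null_sets lebesgue" using N by (simp add: negligible_iff_null_sets)
    have K0m: "K0 \<in> sets lebesgue" using K0(1) by auto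
    have "B \<subseteq> (T \<union> (A - K0)) \<union> N"
      using BK0 by (auto simp: A_def B_def)
    then have "emeasure lebesgue B \<le> emeasure lebesgue ((T \<union> (A - K0)) \<union> N)"
      using T(1) Am K0m Ns by (intro emeasure_mono) auto
    also have "\<dots> = emeasure lebesgue (T \<union> (A - K0))"
      using T(1) Am K0m Ns by (intro emeasure_Un_null_set) auto
    also have "\<dots> \<le> emeasure lebesgue T + emeasure lebesgue (A - K0)"
      using T(1) Am K0m by (intro emeasure_subadditive) auto
    also have "\<dots> < ennreal (\<epsilon> / 2) + ennreal (\<epsilon> / 2)"
      using T(2) K0(3) by (intro add_strict_mono)
    also have "\<dots> = ennreal \<epsilon>" using assms(2) by (simp flip: ennreal_plus)
    finally show ?thesis .
  qed
  then show ?thesis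
    using C1 hor Bm unfolding B_def Let_def by blast
qed

end
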